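(* Suppose that (i) $\widetilde M:=\int_0^\infty\big(\sup_{i\in\mathcal S,u\in U}|f(s,i,u)|+\delta(s)\big)ds<\infty$; (ii) $$\Theta:=\sup_{t\ge0,\,i\in\mathcal S}\ \sup_{u_1,u_2\in U,\,u_1\ne u_2}\Big\{\frac{|f(t,i,u_1)-f(t,i,u_2)|}{|u_1-u_2|}+\frac{|q^{u_1}_i-q^{u_2}_i|}{|u_1-u_2|}\Big\}<\infty;$$ (iii) $U$ satisfies the uniform cone condition; and (iv) $f(\cdot,i,u)$ (for all $i\in\mathcal S$, $u\in U$) and $\delta(\cdot)$ are continuous on $[0,\infty)$. Then for every $\lambda>0$ there exists $y\in\mathbb R^d$ such that $\widetilde\Psi_\lambda(y)=y$. Hence, $\widetilde\Gamma_\lambda(y,\cdot)\in\Pi_r$ is a regular relaxed equilibrium for $\widetilde J_\lambda$.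
   Context: Setting (continuous time). Fix $\ell,d\in\mathbb N$; $U\subset\mathbb R^\ell$ is compact with Lebesgue measure $\mathrm{Leb}(U)>0$; $\mathcal S=\{1,\dots,d\}$. For each $u\in U$, $q^u=(q^u_{ij})$ is a $d\times d$ rate matrix ($q^u_{ij}\ge0$ for $j\ne i$, $q^u_{ii}=-\sum_{j\ne i}q^u_{ij}$), with $i$-th row $q^u_i\in\mathbb R^d$. $\mathcal P(U)$ is the set of Borel probability measures on $U$, $\mathcal D(U)$ the set of probability density functions on $U$ (w.r.t. Lebesgue measure, identified when a.e. equal). For $\mu\in\mathcal P(U)$, $Q^\mu_{ij}:=\int_Uq^u_{ij}\mu(du)$, with $i$-th row $Q^\mu_i$. A relaxed feedback control is a map $\pi:\mathcal S\to\mathcal P(U)$; $\Pi$ is the set of all of them. Under $\pi$, $X^\pi$ is the continuous-time $\mathcal S$-valued Markov chain whose generator has $i$-th row $Q^{\pi(i)}_i$. $\mathbb E_i$ is expectation given $X_0=i$. The reward is $f:[0,\infty)\times\mathcal S\times U\to\mathbb R$, and $f^\mu(t,i):=\int_Uf(t,i,u)\mu(du)$. The discount function $\delta:[0,\infty)\to[0,1]$ is nonincreasing with $\delta(0)=1$. $|\cdot|$ is the Euclidean norm. For $\rho\in\mathcal D(U)$, $\mathcal H(\rho):=-\int_U\ln(\rho(u))\rho(u)\,du$. $\Pi_r$ is the set of regular relaxed feedback controls: those $\pi\in\Pi$ such that each $\pi(i)$ has a density in $\mathcal D(U)$ (identified with $\pi(i)$) with $\mathcal H(\pi(i))>-\infty$.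 For $\lambda>0$, $\pi\in\Pi_r$: $$\widetilde J^\pi_\lambda(i):=\mathbb E_i\Big[\int_0^\infty\big(f^{\pi(X^\pi_s)}(s,X^\pi_s)+\lambda\delta(s)\mathcal H(\pi(X^\pi_s))\big)ds\Big],\qquad \widetilde J^\pi_\lambda=(\widetilde J^\pi_\lambda(1),\dots,\widetilde J^\pi_\lambda(d))\in\mathbb R^d.$$ For $\varepsilon>0$, $\pi'\otimes_\varepsilon\pi$ means using $\pi'$ on $[0,\varepsilon)$ and $\pi$ on $[\varepsilon,\infty)$ (both for the dynamics and in the reward/entropy terms). $\pi\in\Pi_r$ is a regular relaxed equilibrium (for $\widetilde J_\lambda$) if $\limsup_{\varepsilon\downarrow0}\frac{\widetilde J_\lambda^{\pi'\otimes_\varepsilon\pi}(i)-\widetilde J_\lambda^\pi(i)}{\varepsilon}\le0$ for all $\pi'\in\Pi_r$ and $i\in\mathcal S$. $\widetilde\Gamma_\lambda:\mathbb R^d\times\mathcal S\to\mathcal D(U)$ is $$\widetilde\Gamma_\lambda(y,i)(u):=\frac{e^{\frac1\lambda(f(0,i,u)+q^u_i\cdot y)}}{\int_Ue^{\frac1\lambda(f(0,i,v)+q^v_i\cdot y)}dv},$$ and $\widetilde\Psi_\lambda:\mathbb R^d\to\mathbb R^d$ is $\widetilde\Psi_\lambda(y):=\widetilde J_\lambda^{\widetilde\Gamma_\lambda(y,\cdot)}$. Uniform cone condition: if $\ell>1$, there are $\vartheta>0$ and $\iota\in(0,\pi/2]$ such that for every $u\in U$ there is a cone with vertex $u$ and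 angle $\iota$, $\mathrm{cone}(u,\iota)$, with $\mathrm{cone}(u,\iota)\cap B_\vartheta(u)\subseteq U$; if $\ell=1$, there is $\vartheta>0$ such that for every $u\in U$ either $[u-\vartheta,u]\subseteq U$ or $[u,u+\vartheta]\subseteq U$. Here a cone with vertex $u$ and angle $\iota$ is any rotation about $u$ of $u+\Delta_\iota$, where $\Delta_\iota=\{v\in\mathbb R^\ell: v_\ell\ge0,\ v_1^2+\dots+v_{\ell-1}^2\le\tan^2(\iota)v_\ell^2\}$ (the half-space $v_\ell\ge0$ if $\iota=\pi/2$), and $B_\vartheta(u)$ is the ball of radius $\vartheta$ about $u$. *)

theory Defs
  imports "HOL-Probability.Probability"
begin

text \<open>
  The action space \<open>U\<close> is a subset of \<open>real ^ 'l\<close>, the states are the elements of the finite type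
  \<open>'d\<close>, and functions on the states are vectors in \<open>real ^ 'd\<close>.  Functions of time have type
  \<open>real \<Rightarrow> _\<close> and only their values on \<open>{0..}\<close> matter; functions of the action only matter on \<open>U\<close>.
\<close>

section \<open>The uniform cone condition\<close>

text \<open>
  A finite index type has no last element, so the coordinate that plays the role of the last one
  is the parameter \<open>k\<close>.  The half-space is a separate case because \<open>tan (pi/2) = 0\<close> in HOL.
\<close>

definition standard_cone :: "'l::finite \<Rightarrow> real \<Rightarrow> (real ^ 'l) set" where
  "standard_cone k \<iota> =
     {v. v $ k \<ge> 0 \<and>
         (\<iota> = pi / 2 \<or> (\<Sum>j\<in>UNIV - {k}. (v $ j)\<^sup>2) \<le> (tan \<iota>)\<^sup>2 * (v $ k)\<^sup>2)}"

definition is_cone :: "'l::finite \<Rightarrow> real ^ 'l \<Rightarrow> real \<Rightarrow> (real ^ 'l) set \<Rightarrow> bool" where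
  "is_cone k u \<iota> C \<longleftrightarrow>
     (\<exists>R :: real ^ 'l ^ 'l. rotation_matrix R \<and> C = (\<lambda>v. u + R *v v) ` standard_cone k \<iota>)"

definition uniform_cone_condition :: "'l::finite \<Rightarrow> (real ^ 'l) set \<Rightarrow> bool" where
  "uniform_cone_condition k U \<longleftrightarrow>
     (if CARD('l) = 1
      then \<exists>\<theta>>0. \<forall>u\<in>U. cbox (u - vec \<theta>) u \<subseteq> U \<or> cbox u (u + vec \<theta>) \<subseteq> U
      else \<exists>\<theta>>0. \<exists>\<iota>. 0 < \<iota> \<and> \<iota> \<le> pi / 2 \<and>
             (\<forall>u\<in>U. \<exists>C. is_cone k u \<iota> C \<and> C \<inter> ball u \<theta> \<subseteq> U))"


section \<open>Controls, densities and entropy\<close>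

definition rate_matrix :: "real ^ 'd ^ 'd \<Rightarrow> bool" where
  "rate_matrix A \<longleftrightarrow>
     (\<forall>i j. j \<noteq> i \<longrightarrow> A $ i $ j \<ge> 0) \<and> (\<forall>i. A $ i $ i = - (\<Sum>j\<in>UNIV - {i}. A $ i $ j))"

definition prob_measures_on :: "(real ^ 'l) set \<Rightarrow> (real ^ 'l) measure set" where
  "prob_measures_on U = {\<mu>. sets \<mu> = sets (restrict_space borel U) \<and> prob_space \<mu>}"

definition leb_on :: "(real ^ 'l) set \<Rightarrow> (real ^ 'l) measure" where
  "leb_on U = restrict_space lborel U"

definition prob_densities_on :: "(real ^ 'l) set \<Rightarrow> (real ^ 'l \<Rightarrow> real) set" where
  "prob_densities_on U =
     {\<rho>. \<rho> \<in> borel_measurable (leb_on U) \<and> (\<forall>u\<in>U. \<rho> u \<ge> 0) \<and> (\<integral>\<^sup>+u. ennreal (\<rho> u) \<partial>leb_on U) = 1}"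

definition measure_of_density :: "(real ^ 'l) set \<Rightarrow> (real ^ 'l \<Rightarrow> real) \<Rightarrow> (real ^ 'l) measure" where
  "measure_of_density U \<rho> = density (leb_on U) (\<lambda>u. ennreal (\<rho> u))"

definition density_of_measure :: "(real ^ 'l) set \<Rightarrow> (real ^ 'l) measure \<Rightarrow> real ^ 'l \<Rightarrow> real" where
  "density_of_measure U \<mu> = (\<lambda>u. enn2real (RN_deriv (leb_on U) \<mu> u))"

text \<open>
  The entropy is an extended real: the integrals of the positive and the negative part of
  \<open>- ln (\<rho> u) * \<rho> u\<close> are taken separately (\<open>ennreal\<close> truncates negative numbers to \<open>0\<close>).  The first
  one is finite whenever \<open>U\<close> has finite Lebesgue measure, as \<open>- r * ln r \<le> exp (- 1)\<close>, so
  \<open>\<infinity> - \<infinity>\<close> does not occur; the value \<open>- \<infinity>\<close> does.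
\<close>

definition diff_entropy :: "(real ^ 'l) set \<Rightarrow> (real ^ 'l \<Rightarrow> real) \<Rightarrow> ereal" where
  "diff_entropy U \<rho> =
     enn2ereal (\<integral>\<^sup>+u. ennreal (- (ln (\<rho> u) * \<rho> u)) \<partial>leb_on U)
     - enn2ereal (\<integral>\<^sup>+u. ennreal (ln (\<rho> u) * \<rho> u) \<partial>leb_on U)"

type_synonym ('d, 'l) control = "'d \<Rightarrow> (real ^ 'l) measure"

definition relaxed_controls :: "(real ^ 'l) set \<Rightarrow> ('d, 'l) control set" where
  "relaxed_controls U = {\<pi>. \<forall>i. \<pi> i \<in> prob_measures_on U}"

definition regular_controls :: "(real ^ 'l) set \<Rightarrow> ('d, 'l) control set" where
  "regular_controls U =
     {\<pi> \<in> relaxed_controls U.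
        \<forall>i. \<exists>\<rho>\<in>prob_densities_on U. \<pi> i = measure_of_density U \<rho> \<and> diff_entropy U \<rho> > - \<infinity>}"

text \<open>
  Time-dependent controls: constant ones \<open>\<lambda>_. \<pi>\<close>, and \<open>concat_control \<pi>' \<epsilon> \<pi>\<close>, which uses \<open>\<pi>'\<close>
  before time \<open>\<epsilon>\<close> and \<open>\<pi>\<close> from \<open>\<epsilon>\<close> on.
\<close>

type_synonym ('d, 'l) policy = "real \<Rightarrow> ('d, 'l) control"

definition concat_control ::
  "('d, 'l) control \<Rightarrow> real \<Rightarrow> ('d, 'l) control \<Rightarrow> ('d, 'l) policy" where
  "concat_control \<pi>' \<epsilon> \<pi> = (\<lambda>t. if t < \<epsilon> then \<pi>' else \<pi>)"

definition control_generator ::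
  "(real ^ 'l \<Rightarrow> real ^ 'd ^ 'd) \<Rightarrow> ('d, 'l) control \<Rightarrow> real ^ 'd ^ 'd" where
  "control_generator q \<pi> = (\<chi> i j. \<integral>u. q u $ i $ j \<partial>\<pi> i)"


section \<open>The controlled Markov chain\<close>

text \<open>
  \<open>P s t\<close> are the transition matrices belonging to the generators \<open>A t\<close>: the unique solution of the
  Kolmogorov forward equation \<open>\<partial>P s t / \<partial>t = P s t ** A t\<close>, \<open>P s s = mat 1\<close>.  It is integrated
  because \<open>A\<close> may jump; for constant \<open>A\<close> it says \<open>P s t = exp ((t - s) A)\<close>.
\<close>

definition transition_matrices ::
  "(real \<Rightarrow> real ^ 'd ^ 'd) \<Rightarrow> (real \<Rightarrow> real \<Rightarrow> real ^ 'd ^ 'd::finite) \<Rightarrow> bool" where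
  "transition_matrices A P \<longleftrightarrow>
     (\<forall>s t. 0 \<le> s \<and> s \<le> t \<longrightarrow> ((\<lambda>r. P s r ** A r) has_integral (P s t - mat 1)) {s..t})"

text \<open>
  A right-continuous Markov chain on \<open>{0..}\<close> with start in \<open>i\<close> and generator \<open>A t\<close> at time \<open>t\<close>.
  The Markov property is stated without conditional probabilities:
  \<open>Pr (X t\<^sub>0 = x\<^sub>0, \<dots>, X t\<^sub>n\<^sub>+\<^sub>1 = x\<^sub>n\<^sub>+\<^sub>1) = Pr (X t\<^sub>0 = x\<^sub>0, \<dots>, X t\<^sub>n = x\<^sub>n) \<cdot> (P t\<^sub>n t\<^sub>n\<^sub>+\<^sub>1)(x\<^sub>n, x\<^sub>n\<^sub>+\<^sub>1)\<close>.
\<close>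

definition markov_chain ::
  "'w measure \<Rightarrow> (real \<Rightarrow> 'w \<Rightarrow> 'd) \<Rightarrow> (real \<Rightarrow> real ^ 'd ^ 'd) \<Rightarrow> 'd::finite \<Rightarrow> bool" where
  "markov_chain M X A i \<longleftrightarrow>
     prob_space M \<and>
     (\<forall>t\<ge>0. X t \<in> measurable M (count_space UNIV)) \<and>
     (\<forall>w\<in>space M. \<forall>t\<ge>0. \<forall>\<^sub>F s in at_right t. X s w = X t w) \<and>
     (AE w in M. X 0 w = i) \<and>
     (\<exists>P. transition_matrices A P \<and>
        (\<forall>n t x. 0 \<le> t 0 \<and> (\<forall>k\<le>n. t k < t (Suc k)) \<longrightarrow>
           measure M {w \<in> space M. \<forall>k\<le>Suc n. X (t k) w = x k}
           = measure M {w \<in> space M. \<forall>k\<le>n. X (t k) w = x k} * P (t n) (t (Suc n)) $ x n $ x (Suc n)))"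

text \<open>
  \<open>X \<alpha>\<close> is the state process under the policy \<open>\<alpha>\<close> and \<open>Pr \<alpha> i\<close> its law with start in \<open>i\<close>.  Any
  realization of these chains is allowed.
\<close>

definition controlled_chains ::
  "(real ^ 'l) set \<Rightarrow> (real ^ 'l \<Rightarrow> real ^ 'd ^ 'd) \<Rightarrow>
   (('d::finite, 'l) policy \<Rightarrow> 'd \<Rightarrow> 'w measure) \<Rightarrow>
   (('d, 'l) policy \<Rightarrow> real \<Rightarrow> 'w \<Rightarrow> 'd) \<Rightarrow> bool" where
  "controlled_chains U q Pr X \<longleftrightarrow>
     (\<forall>\<pi>\<in>regular_controls U. \<forall>i.
        markov_chain (Pr (\<lambda>_. \<pi>) i) (X (\<lambda>_. \<pi>)) (\<lambda>_. control_generator q \<pi>) i) \<and>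
     (\<forall>\<pi>'\<in>regular_controls U. \<forall>\<pi>\<in>regular_controls U. \<forall>\<epsilon>>0. \<forall>i.
        markov_chain (Pr (concat_control \<pi>' \<epsilon> \<pi>) i) (X (concat_control \<pi>' \<epsilon> \<pi>))
          (\<lambda>t. control_generator q (concat_control \<pi>' \<epsilon> \<pi> t)) i)"


section \<open>Value function, equilibria and the fixed-point map\<close>

definition averaged_reward ::
  "(real \<Rightarrow> 'd \<Rightarrow> real ^ 'l \<Rightarrow> real) \<Rightarrow> (real ^ 'l) measure \<Rightarrow> real \<Rightarrow> 'd \<Rightarrow> real" where
  "averaged_reward f \<mu> t i = (\<integral>u. f t i u \<partial>\<mu>)"

definition regularized_value ::
  "(real ^ 'l) set \<Rightarrow> (real \<Rightarrow> 'd \<Rightarrow> real ^ 'l \<Rightarrow> real) \<Rightarrow> (real \<Rightarrow> real) \<Rightarrow>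
   (('d::finite, 'l) policy \<Rightarrow> 'd \<Rightarrow> 'w measure) \<Rightarrow> (('d, 'l) policy \<Rightarrow> real \<Rightarrow> 'w \<Rightarrow> 'd) \<Rightarrow>
   real \<Rightarrow> ('d, 'l) policy \<Rightarrow> real ^ 'd" where
  "regularized_value U f \<delta> Pr X lam \<alpha> =
     (\<chi> i. \<integral>w. (LBINT s:{0..}.
         averaged_reward f (\<alpha> s (X \<alpha> s w)) s (X \<alpha> s w)
         + lam * \<delta> s * real_of_ereal (diff_entropy U (density_of_measure U (\<alpha> s (X \<alpha> s w)))))
       \<partial>Pr \<alpha> i)"

definition regular_equilibrium ::
  "(real ^ 'l) set \<Rightarrow> (real \<Rightarrow> 'd \<Rightarrow> real ^ 'l \<Rightarrow> real) \<Rightarrow> (real \<Rightarrow> real) \<Rightarrow>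
   (('d::finite, 'l) policy \<Rightarrow> 'd \<Rightarrow> 'w measure) \<Rightarrow> (('d, 'l) policy \<Rightarrow> real \<Rightarrow> 'w \<Rightarrow> 'd) \<Rightarrow>
   real \<Rightarrow> ('d, 'l) control \<Rightarrow> bool" where
  "regular_equilibrium U f \<delta> Pr X lam \<pi> \<longleftrightarrow>
     \<pi> \<in> regular_controls U \<and>
     (\<forall>\<pi>'\<in>regular_controls U. \<forall>i.
        Limsup (at_right 0) (\<lambda>\<epsilon>. ereal
          ((regularized_value U f \<delta> Pr X lam (concat_control \<pi>' \<epsilon> \<pi>) $ i
            - regularized_value U f \<delta> Pr X lam (\<lambda>_. \<pi>) $ i) / \<epsilon>)) \<le> 0)"

definition gibbs_density ::
  "(real ^ 'l) set \<Rightarrow> (real ^ 'l \<Rightarrow> real ^ 'd ^ 'd::finite) \<Rightarrow>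
   (real \<Rightarrow> 'd \<Rightarrow> real ^ 'l \<Rightarrow> real) \<Rightarrow> real \<Rightarrow> real ^ 'd \<Rightarrow> 'd \<Rightarrow> real ^ 'l \<Rightarrow> real" where
  "gibbs_density U q f lam y i u =
     exp (1 / lam * (f 0 i u + (q u $ i) \<bullet> y))
     / (\<integral>v. exp (1 / lam * (f 0 i v + (q v $ i) \<bullet> y)) \<partial>leb_on U)"

definition gibbs_control ::
  "(real ^ 'l) set \<Rightarrow> (real ^ 'l \<Rightarrow> real ^ 'd ^ 'd::finite) \<Rightarrow>
   (real \<Rightarrow> 'd \<Rightarrow> real ^ 'l \<Rightarrow> real) \<Rightarrow> real \<Rightarrow> real ^ 'd \<Rightarrow> ('d, 'l) control" where
  "gibbs_control U q f lam y = (\<lambda>i. measure_of_density U (gibbs_density U q f lam y i))"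

definition value_map ::
  "(real ^ 'l) set \<Rightarrow> (real ^ 'l \<Rightarrow> real ^ 'd ^ 'd) \<Rightarrow>
   (real \<Rightarrow> 'd \<Rightarrow> real ^ 'l \<Rightarrow> real) \<Rightarrow> (real \<Rightarrow> real) \<Rightarrow>
   (('d::finite, 'l) policy \<Rightarrow> 'd \<Rightarrow> 'w measure) \<Rightarrow> (('d, 'l) policy \<Rightarrow> real \<Rightarrow> 'w \<Rightarrow> 'd) \<Rightarrow>
   real \<Rightarrow> real ^ 'd \<Rightarrow> real ^ 'd" where
  "value_map U q f \<delta> Pr X lam y =
     regularized_value U f \<delta> Pr X lam (\<lambda>_. gibbs_control U q f lam y)"

end

theory Submission
  imports Defs "HOL-Real_Asymp.Real_Asymp"
begin

text \<open>
  A chain with start in \<open>i\<close> enters the value only through its marginal laws, which solve the forward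
  equation \<open>p' = p A\<close> with initial value \<open>axis i 1\<close>; so a value is an integral over time of these laws
  against the state-wise rewards.

  Fixed point: Gronwall makes the laws, and then \<open>value_map\<close>, continuous in \<open>y\<close>.  The log-density
  of the Gibbs control is Lipschitz with constant \<open>O(1 + |y|)\<close>, hence within \<open>1\<close> of its maximum on a
  ball of radius of order \<open>1 / (1 + |y|)\<close>, a fixed proportion of which lies in \<open>U\<close> by the cone
  condition.  The entropy, and with it \<open>value_map\<close>, grows at most logarithmically in \<open>y\<close>, so a
  large ball is mapped into itself and Brouwer's theorem applies.

  Equilibrium: the derivative at \<open>\<epsilon> = 0\<close> of the value of \<open>concat_control \<pi>' \<epsilon> \<pi>\<close> is the difference
  between \<open>\<pi>'\<close> and \<open>\<pi>\<close> of the functional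
  \<open>\<mu> \<mapsto> \<integral> (f 0 i u + q u $ i \<bullet> y) d\<mu> + lam * entropy \<mu>\<close> with \<open>y\<close> the value of \<open>\<pi>\<close>, and the Gibbs
  density maximizes this functional.
\<close>

section \<open>Linear forward equations\<close>

text \<open>The processes of different policies are arbitrary realizations with no coupling between
  them, so paths are never compared; every comparison goes through the marginal laws, where
  linearity of the equation provides uniqueness and stability. Since the discount need not be
  exponential, the payoff collected after \<epsilon> is not a value of the original problem: the law
  restarts at \<epsilon>, but the rewards keep their calendar time. Only as \<epsilon> tends to 0
  does this payoff become the value of the control itself, and this is how the value gets into the
  Gibbs exponent. The obstacle to a fixed point is that the entropy is bounded above by the log
  volume of \<open>U\<close> but not below, since a concentrated density has very negative entropy.
  In dimension n a ball of radius r has log volume n ln r plus a constant, which turns the radius of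
  order 1 / (1 + |y|) into a logarithm.\<close>

lemma bounded_bilinear_vector_matrix_mult:
  "bounded_bilinear (\<lambda>(x :: real ^ 'm::finite) (A :: real ^ 'n::finite ^ 'm). x v* A)"
  unfolding bilinear_conv_bounded_bilinear[symmetric] bilinear_def
  by (intro conjI allI linearI vector_matrix_left_distrib vector_matrix_mult_add_rdistrib
      scaleR_vector_matrix_assoc vector_scaleR_matrix_ac)

lemma norm_vector_matrix_mult_bound:
  obtains c :: real where "c > 0"
    "\<And>(x :: real ^ 'm::finite) (A :: real ^ 'n::finite ^ 'm). norm (x v* A) \<le> c * norm x * norm A"
  using bounded_bilinear.pos_bounded[OF bounded_bilinear_vector_matrix_mult]
  by (metis mult.commute mult.left_commute)

text \<open>Differentiating the squared norm avoids the point where the norm is not smooth. Young's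
  inequality 2 |D| e \<le> |D|^2 + e^2 is the origin of the \<open>+ 1\<close> in the exponent and
  of the factor \<open>e\<^sup>2\<close>.\<close>

lemma gronwall_norm_square:
  fixes D :: "real \<Rightarrow> 'a::real_inner"
  assumes D: "\<And>r. r \<in> {0..T} \<Longrightarrow> (D has_vector_derivative v r) (at r within {0..T})"
    and v: "\<And>r. r \<in> {0..T} \<Longrightarrow> norm (v r) \<le> c * norm (D r) + e"
    and "D 0 = 0" "c \<ge> 0" "T \<ge> 0"
  shows "(norm (D T))\<^sup>2 \<le> e\<^sup>2 * T * exp ((2 * c + 1) * T)"
proof -
  define k where "k = 2 * c + 1"
  have "k \<ge> 0" using \<open>c \<ge> 0\<close> by (simp add: k_def)
  \<comment> \<open>With the integrating factor for the rate \<open>k\<close> and the accumulated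
    error \<open>e\<^sup>2 * r\<close> subtracted, \<open>h\<close> is nonincreasing and vanishes at
    0.\<close>
  define h where "h r = (D r \<bullet> D r) * exp (- k * r) - e\<^sup>2 * r" for r
  have deriv: "(h has_real_derivative ((2 * (D r \<bullet> v r)) * exp (- k * r)
      - k * (D r \<bullet> D r) * exp (- k * r) - e\<^sup>2)) (at r within {0..T})" if "r \<in> {0..T}" for r
  proof -
    have "((\<lambda>r. D r \<bullet> D r) has_real_derivative 2 * (D r \<bullet> v r)) (at r within {0..T})"
      using bounded_bilinear.has_vector_derivative[OF bounded_bilinear_inner D[OF that] D[OF that]]
      by (simp add: has_real_derivative_iff_has_vector_derivative inner_commute)
    moreover have "((\<lambda>r. exp (- k * r)) has_real_derivative - k * exp (- k * r)) (at r within {0..T})"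
      by (auto intro!: derivative_eq_intros)
    moreover have "((\<lambda>r. e\<^sup>2 * r) has_real_derivative e\<^sup>2) (at r within {0..T})"
      by (auto intro!: derivative_eq_intros)
    ultimately have "((\<lambda>r. (D r \<bullet> D r) * exp (- k * r) - e\<^sup>2 * r) has_real_derivative
        (D r \<bullet> D r) * (- k * exp (- k * r)) + 2 * (D r \<bullet> v r) * exp (- k * r) - e\<^sup>2) (at r within {0..T})"
      by (intro DERIV_diff DERIV_mult')
    moreover have "(D r \<bullet> D r) * (- k * exp (- k * r)) + 2 * (D r \<bullet> v r) * exp (- k * r) - e\<^sup>2
      = 2 * (D r \<bullet> v r) * exp (- k * r) - k * (D r \<bullet> D r) * exp (- k * r) - e\<^sup>2"
      by algebra
    ultimately show ?thesis
      unfolding h_def by (rule DERIV_cong)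
  qed
  have "h T \<le> h 0"
  proof (rule DERIV_nonpos_imp_decreasing_open[OF \<open>T \<ge> 0\<close>])
    fix r assume r: "0 < r" "r < T"
    then have r': "r \<in> {0..T}" by simp
    have "D r \<bullet> v r \<le> norm (D r) * norm (v r)"
      by (rule norm_cauchy_schwarz)
    also have "\<dots> \<le> norm (D r) * (c * norm (D r) + e)"
      by (intro mult_left_mono v r') simp
    finally have 1: "D r \<bullet> v r \<le> norm (D r) * (c * norm (D r) + e)" .
    \<comment> \<open>Completing the square; \<open>(norm (D r) - e)\<^sup>2\<close> is what Young's
      inequality discards.\<close>
    have "2 * (norm (D r) * (c * norm (D r) + e)) = k * (norm (D r))\<^sup>2 + e\<^sup>2 - (norm (D r) - e)\<^sup>2"
      unfolding k_def by algebra
    then have "2 * (norm (D r) * (c * norm (D r) + e)) \<le> k * (D r \<bullet> D r) + e\<^sup>2"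
      by (simp add: dot_square_norm)
    with 1 have "2 * (D r \<bullet> v r) - k * (D r \<bullet> D r) \<le> e\<^sup>2" by simp
    then have "(2 * (D r \<bullet> v r) - k * (D r \<bullet> D r)) * exp (- k * r) \<le> e\<^sup>2 * exp (- k * r)"
      by (simp add: mult_right_mono)
    also have "e\<^sup>2 * exp (- k * r) \<le> e\<^sup>2"
      using r \<open>k \<ge> 0\<close> by (intro mult_left_le) auto
    finally have "2 * (D r \<bullet> v r) * exp (- k * r) - k * (D r \<bullet> D r) * exp (- k * r) - e\<^sup>2 \<le> 0"
      by (simp add: left_diff_distrib)
    moreover note deriv[OF r', unfolded at_within_Icc_at[OF r]]
    ultimately show "\<exists>y. (h has_real_derivative y) (at r) \<and> y \<le> 0"
      by blast
  next
    show "continuous_on {0..T} h"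
      by (rule DERIV_continuous_on[OF deriv])
  qed
  then have *: "(norm (D T))\<^sup>2 * exp (- k * T) \<le> e\<^sup>2 * T"
    by (simp add: h_def \<open>D 0 = 0\<close> dot_square_norm)
  have "(norm (D T))\<^sup>2 = (norm (D T))\<^sup>2 * exp (- k * T) * exp (k * T)"
    by (simp only: mult.assoc exp_add[symmetric]) simp
  also have "\<dots> \<le> e\<^sup>2 * T * exp (k * T)"
    by (rule mult_right_mono[OF *]) simp
  finally show ?thesis
    unfolding k_def .
qed

text \<open>The integrated form allows \<open>A\<close> to jump at the switching time, and the
  finite horizon \<open>T\<close> lets a switched generator be compared with a constant one up to
  the switch.\<close>

definition forward_solution ::
  "(real \<Rightarrow> real ^ 'd ^ 'd) \<Rightarrow> real ^ 'd \<Rightarrow> real \<Rightarrow> (real \<Rightarrow> real ^ 'd::finite) \<Rightarrow> bool" where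
  "forward_solution A x T p \<longleftrightarrow> (\<forall>t\<in>{0..T}. ((\<lambda>r. p r v* A r) has_integral (p t - x)) {0..t})"

lemma forward_solution_initial: "forward_solution A x T p \<Longrightarrow> 0 \<le> T \<Longrightarrow> p 0 = x"
  unfolding forward_solution_def
  using has_integral_unique[OF _ has_integral_refl(2)[of "\<lambda>r. p r v* A r" 0], of "p 0 - x"]
  by (auto dest!: bspec[of _ _ 0])

lemma forward_solution_mono: "forward_solution A x T p \<Longrightarrow> T' \<le> T \<Longrightarrow> forward_solution A x T' p"
  unfolding forward_solution_def by auto

text \<open>Agreement is asked only strictly before \<open>T\<close>: a concatenated control already
  follows the new control at the switching time, and one point does not change an integral.\<close>

lemma forward_solution_cong:
  assumes "forward_solution A x T p" "\<And>t. 0 \<le> t \<Longrightarrow> t < T \<Longrightarrow> A t = A' t"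
  shows "forward_solution A' x T p"
  unfolding forward_solution_def
proof
  fix t assume t: "t \<in> {0..T}"
  show "((\<lambda>r. p r v* A' r) has_integral p t - x) {0..t}"
  proof (rule has_integral_spike_finite[of "{t}"])
    show "((\<lambda>r. p r v* A r) has_integral p t - x) {0..t}"
      using assms(1) t by (auto simp: forward_solution_def)
  qed (use t assms(2) in auto)
qed

lemma forward_solution_continuous:
  assumes "forward_solution A x T p" "0 \<le> T"
  shows "continuous_on {0..T} p"
proof -
  have *: "((\<lambda>r. p r v* A r) has_integral (p t - x)) {0..t}" if "t \<in> {0..T}" for t
    using assms(1) that by (auto simp: forward_solution_def)
  have "continuous_on {0..T} (\<lambda>t. integral {0..t} (\<lambda>r. p r v* A r))"
    using *[of T] assms(2) by (intro indefinite_integral_continuous_1) auto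
  then have "continuous_on {0..T} (\<lambda>t. x + integral {0..t} (\<lambda>r. p r v* A r))"
    by (intro continuous_intros)
  then show ?thesis
    by (rule continuous_on_eq) (use integral_unique[OF *] in auto)
qed

lemma forward_solution_has_vector_derivative:
  assumes p: "forward_solution (\<lambda>_. A) x T p" and t: "t \<in> {0..T}"
  shows "(p has_vector_derivative (p t v* A)) (at t within {0..T})"
proof -
  have *: "((\<lambda>r. p r v* A) has_integral (p t - x)) {0..t}" if "t \<in> {0..T}" for t
    using p that by (auto simp: forward_solution_def)
  have "continuous_on {0..T} (\<lambda>r. p r v* A)"
    using forward_solution_continuous[OF p] t
    by (intro bounded_linear.continuous_on[OF bounded_bilinear.bounded_linear_left
          [OF bounded_bilinear_vector_matrix_mult]]) auto
  from integral_has_vector_derivative[OF this t]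
  have "((\<lambda>t. integral {0..t} (\<lambda>r. p r v* A)) has_vector_derivative (p t v* A)) (at t within {0..T})" .
  then have "((\<lambda>t. x + integral {0..t} (\<lambda>r. p r v* A)) has_vector_derivative (p t v* A)) (at t within {0..T})"
    by (auto intro!: derivative_eq_intros)
  then show ?thesis
    by (rule has_vector_derivative_transform[OF t, rotated]) (use integral_unique[OF *] in auto)
qed

text \<open>Gronwall for \<open>p - p'\<close>. The constant \<open>c\<close> depends only on the
  dimension, so it serves all generators at once. Equal generators give uniqueness, nearby ones the
  continuity of the laws in y.\<close>

lemma forward_solution_stability:
  obtains c :: real where "c > 0"
    "\<And>(A :: real ^ 'd ^ 'd::finite) B x T p p' b.
      forward_solution (\<lambda>_. A) x T p \<Longrightarrow> forward_solution (\<lambda>_. B) x T p' \<Longrightarrow> 0 \<le> T \<Longrightarrow>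
      (\<And>t. t \<in> {0..T} \<Longrightarrow> norm (p' t) \<le> b) \<Longrightarrow>
      (norm (p T - p' T))\<^sup>2 \<le> (c * b * norm (A - B))\<^sup>2 * T * exp ((2 * (c * norm A) + 1) * T)"
proof -
  obtain c :: real where c: "c > 0"
    "\<And>(x :: real ^ 'd) (A :: real ^ 'd ^ 'd). norm (x v* A) \<le> c * norm x * norm A"
    using norm_vector_matrix_mult_bound by blast
  show ?thesis
  proof (rule that[OF c(1)])
    fix A B :: "real ^ 'd ^ 'd" and x T p p' and b :: real
    assume p: "forward_solution (\<lambda>_. A) x T p" and p': "forward_solution (\<lambda>_. B) x T p'"
      and T: "0 \<le> T" and b: "\<And>t. t \<in> {0..T} \<Longrightarrow> norm (p' t) \<le> b"
    show "(norm (p T - p' T))\<^sup>2 \<le> (c * b * norm (A - B))\<^sup>2 * T * exp ((2 * (c * norm A) + 1) * T)"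
    proof (rule gronwall_norm_square[where D = "\<lambda>t. p t - p' t" and v = "\<lambda>t. p t v* A - p' t v* B"])
      fix r assume r: "r \<in> {0..T}"
      show "((\<lambda>t. p t - p' t) has_vector_derivative p r v* A - p' r v* B) (at r within {0..T})"
        using forward_solution_has_vector_derivative[OF p r] forward_solution_has_vector_derivative[OF p' r]
        by (auto intro!: derivative_eq_intros)
      \<comment> \<open>The first summand is the Gronwall term; the second is the error, for which
        only \<open>p'\<close> has to be bounded.\<close>
      have "p r v* A - p' r v* B = (p r - p' r) v* A + p' r v* (A - B)"
        by (simp add: vector_matrix_mult_diff_distrib vector_matrix_mult_diff_rdistrib)
      also have "norm \<dots> \<le> c * norm (p r - p' r) * norm A + c * norm (p' r) * norm (A - B)"
        by (meson add_mono c(2) norm_triangle_le)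
      also have "\<dots> \<le> c * norm A * norm (p r - p' r) + c * b * norm (A - B)"
        using b[OF r] c(1) by (intro add_mono mult_right_mono mult_left_mono) auto
      finally show "norm (p r v* A - p' r v* B) \<le> c * norm A * norm (p r - p' r) + c * b * norm (A - B)" .
    qed (use p p' T c in \<open>auto simp: forward_solution_initial\<close>)
  qed
qed

text \<open>For equal generators the error term of the stability estimate vanishes, so any bound on
  \<open>p'\<close> will do; continuity on a compact interval supplies one.\<close>

lemma forward_solution_unique:
  assumes p: "forward_solution (\<lambda>_. A) x T p" and p': "forward_solution (\<lambda>_. A) x T p'" and t: "t \<in> {0..T}"
  shows "p t = p' t"
proof -
  obtain c :: real where "c > 0" and c:
    "\<And>(A :: real ^ 'a ^ 'a::finite) B x T p p' b.
      forward_solution (\<lambda>_. A) x T p \<Longrightarrow> forward_solution (\<lambda>_. B) x T p' \<Longrightarrow> 0 \<le> T \<Longrightarrow>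
      (\<And>t. t \<in> {0..T} \<Longrightarrow> norm (p' t) \<le> b) \<Longrightarrow>
      (norm (p T - p' T))\<^sup>2 \<le> (c * b * norm (A - B))\<^sup>2 * T * exp ((2 * (c * norm A) + 1) * T)"
    using forward_solution_stability by metis
  have "compact (p' ` {0..T})"
    using forward_solution_continuous[OF p'] t by (intro compact_continuous_image) auto
  then have "bounded (p' ` {0..T})"
    by (rule compact_imp_bounded)
  then obtain b where "\<forall>y\<in>p' ` {0..T}. norm y \<le> b"
    unfolding bounded_iff by blast
  then have b: "norm (p' t) \<le> b" if "t \<in> {0..T}" for t
    using that by simp
  have "(norm (p t - p' t))\<^sup>2 \<le> (c * b * norm (A - A))\<^sup>2 * t * exp ((2 * (c * norm A) + 1) * t)"
    by (rule c) (use t b p p' in \<open>auto intro: forward_solution_mono\<close>)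
  then show ?thesis by simp
qed

text \<open>Shifted by \<open>s\<close>, both sides solve the equation for \<open>B\<close> with
  initial value \<open>p s\<close>, the right one by linearity. This is the Chapman-Kolmogorov
  equation for a generator that is constant from \<open>s\<close> on.\<close>

lemma forward_solution_restart:
  assumes p: "\<And>T. forward_solution A x T p" and A: "\<And>t. t \<ge> s \<Longrightarrow> A t = B"
    and P: "\<And>T j. forward_solution (\<lambda>_. B) (axis j 1) T (P j)" and s: "0 \<le> s" "s \<le> t"
  shows "p t = (\<Sum>j\<in>UNIV. p s $ j *\<^sub>R P j (t - s))"
proof -
  have "forward_solution (\<lambda>_. B) (p s) T (\<lambda>t. p (t + s))" for T
    unfolding forward_solution_def
  proof
    fix t assume t: "t \<in> {0..T}"
    have 1: "((\<lambda>r. p r v* A r) has_integral (p s - x)) {0..s}"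
      using p[of s] s by (simp add: forward_solution_def)
    have 2: "((\<lambda>r. p r v* A r) has_integral (p (t + s) - x)) {0..t + s}"
      using p[of "t + s"] s t by (simp add: forward_solution_def)
    have "(\<lambda>r. p r v* A r) integrable_on {s..t + s}"
      using has_integral_integrable[OF 2] by (rule integrable_on_subinterval) (use s in auto)
    then obtain y where y: "((\<lambda>r. p r v* A r) has_integral y) {s..t + s}" by blast
    from has_integral_unique[OF has_integral_combine[OF _ _ 1 this] 2] s t
    have "p s - x + y = p (t + s) - x" by auto
    then have "y = p (t + s) - p s" by (simp add: algebra_simps)
    with y have "((\<lambda>r. p r v* A r) has_integral (p (t + s) - p s)) {s..t + s}" by simp
    then have "((\<lambda>r. p r v* B) has_integral (p (t + s) - p s)) {s..t + s}"
      by (rule has_integral_eq[rotated]) (auto simp: A)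
    then have "((\<lambda>r. p (r + s) v* B) has_integral (p (t + s) - p s)) (cbox (s - s) (t + s - s))"
      using has_integral_shift_Icc_real[of "\<lambda>r. p r v* B" s _ 0 t] by (simp add: o_def add.commute)
    then show "((\<lambda>r. p (r + s) v* B) has_integral p (t + s) - p s) {0..t}" by simp
  qed
  moreover have "forward_solution (\<lambda>_. B) (p s) T (\<lambda>t. \<Sum>j\<in>UNIV. p s $ j *\<^sub>R P j t)" for T
    unfolding forward_solution_def
  proof
    fix t assume t: "t \<in> {0..T}"
    have "((\<lambda>r. \<Sum>j\<in>UNIV. p s $ j *\<^sub>R (P j r v* B)) has_integral
        (\<Sum>j\<in>UNIV. p s $ j *\<^sub>R (P j t - axis j 1))) {0..t}"
      using P t by (intro has_integral_sum has_integral_cmul) (auto simp: forward_solution_def)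
    moreover have "(\<Sum>j\<in>UNIV. p s $ j *\<^sub>R (axis j 1)) = p s"
      using basis_expansion[of "p s"] by (simp add: scalar_mult_eq_scaleR)
    moreover have "(\<Sum>j\<in>UNIV. p s $ j *\<^sub>R (P j r v* B)) = (\<Sum>j\<in>UNIV. p s $ j *\<^sub>R P j r) v* B" for r
      by (simp add: bounded_bilinear.sum_left[OF bounded_bilinear_vector_matrix_mult]
          scaleR_vector_matrix_assoc)
    ultimately show "((\<lambda>r. (\<Sum>j\<in>UNIV. p s $ j *\<^sub>R P j r) v* B) has_integral
        (\<Sum>j\<in>UNIV. p s $ j *\<^sub>R P j t) - p s) {0..t}"
      by (simp add: scaleR_diff_right sum_subtractf)
  qed
  ultimately have "p ((t - s) + s) = (\<Sum>j\<in>UNIV. p s $ j *\<^sub>R P j (t - s))"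
    by (rule forward_solution_unique[of _ _ "t - s"]) (use s in auto)
  then show ?thesis by simp
qed

section \<open>Marginal laws of the chain\<close>

definition marginal_law :: "'w measure \<Rightarrow> (real \<Rightarrow> 'w \<Rightarrow> 'd) \<Rightarrow> real \<Rightarrow> real ^ 'd::finite" where
  "marginal_law M X t = (\<chi> j. measure M {w \<in> space M. X t w = j})"

lemma marginal_law_nonneg: "marginal_law M X t $ j \<ge> 0"
  by (simp add: marginal_law_def)

lemma marginal_law_le_1: "prob_space M \<Longrightarrow> marginal_law M X t $ j \<le> 1"
  by (simp add: marginal_law_def prob_space.prob_le_1)

lemma norm_marginal_law_le:
  fixes X :: "real \<Rightarrow> 'w \<Rightarrow> 'd::finite"
  assumes "prob_space M"
  shows "norm (marginal_law M X t) \<le> real CARD('d)"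
proof -
  have "norm (marginal_law M X t) \<le> (\<Sum>j\<in>UNIV. \<bar>marginal_law M X t $ j\<bar>)"
    by (rule norm_le_l1_cart)
  also have "\<dots> \<le> (\<Sum>j\<in>(UNIV :: 'd set). 1)"
    using marginal_law_nonneg[of M X t] marginal_law_le_1[OF assms, of X t] by (intro sum_mono) auto
  finally show ?thesis by simp
qed

text \<open>As the start is almost surely \<open>i\<close>, the joint law of \<open>X 0\<close> and
  \<open>X t\<close> reduces to the law of \<open>X t\<close>, which is therefore row
  \<open>i\<close> of \<open>P 0 t\<close>; the claim is row \<open>i\<close> of the matrix
  equation.\<close>

lemma markov_chain_marginal_law:
  assumes mc: "markov_chain M X A i"
  shows "forward_solution A (axis i 1) T (marginal_law M X)"
proof -
  interpret prob_space M using mc by (simp add: markov_chain_def)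
  have X[measurable]: "X t \<in> measurable M (count_space UNIV)" if "t \<ge> 0" for t
    using mc that by (simp add: markov_chain_def)
  have X0: "AE w in M. X 0 w = i" using mc by (simp add: markov_chain_def)
  obtain P where P: "transition_matrices A P"
    and fdd: "\<And>n t x. 0 \<le> t 0 \<Longrightarrow> (\<forall>k\<le>n. t k < t (Suc k)) \<Longrightarrow>
           measure M {w \<in> space M. \<forall>k\<le>Suc n. X (t k) w = x k}
           = measure M {w \<in> space M. \<forall>k\<le>n. X (t k) w = x k} * P (t n) (t (Suc n)) $ x n $ x (Suc n)"
    using mc unfolding markov_chain_def by blast
  have meas0: "measure M {w \<in> space M. X 0 w = i} = 1"
    using X0 X[of 0] by (subst prob_Collect_eq_1) auto
  have law0: "marginal_law M X 0 = axis i 1"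
  proof (subst vec_eq_iff, rule allI)
    fix j
    have "measure M {w \<in> space M. X 0 w = j} = (if j = i then 1 else 0)"
    proof (cases "j = i")
      case False
      have "measure M {w \<in> space M. X 0 w = j} = 0"
        using X0 X[of 0] False by (subst prob_Collect_eq_0) (auto elim: eventually_mono)
      with False show ?thesis by simp
    qed (simp add: meas0)
    then show "marginal_law M X 0 $ j = axis i 1 $ j"
      by (simp add: marginal_law_def axis_def)
  qed
  have PI: "((\<lambda>r. P 0 r ** A r) has_integral (P 0 t - mat 1)) {0..t}" if "0 \<le> t" for t
    using P that by (simp add: transition_matrices_def)
  have law: "marginal_law M X t = P 0 t $ i" if "t \<ge> 0" for t
  \<comment> \<open>The Markov identity needs strictly increasing times, so time 0 is read off the
    initial conditions.\<close>
  proof (cases "t = 0")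
    case True
    have "P 0 0 - mat 1 = 0"
      using has_integral_unique[OF PI[of 0]] has_integral_refl(2)[of "\<lambda>r. P 0 r ** A r" 0] by auto
    then have "P 0 0 = mat 1" by simp
    then show ?thesis
      using True law0 by (simp add: vec_eq_iff axis_def mat_def)
  next
    case False
    show ?thesis
    proof (subst vec_eq_iff, rule allI)
      fix j
      \<comment> \<open>For \<open>n = 0\<close> the times have to increase only from index 0 to
        index 1, so \<open>\<tau>\<close> may be constant afterwards.\<close>
      define \<tau> :: "nat \<Rightarrow> real" where "\<tau> k = (if k = 0 then 0 else t)" for k
      define x where "x k = (if k = (0::nat) then i else j)" for k
      have "measure M {w \<in> space M. \<forall>k\<le>Suc 0. X (\<tau> k) w = x k}
          = measure M {w \<in> space M. \<forall>k\<le>0. X (\<tau> k) w = x k} * P (\<tau> 0) (\<tau> (Suc 0)) $ x 0 $ x (Suc 0)"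
        by (rule fdd) (use False \<open>t \<ge> 0\<close> in \<open>auto simp: \<tau>_def\<close>)
      also have "{w \<in> space M. \<forall>k\<le>0. X (\<tau> k) w = x k} = {w \<in> space M. X 0 w = i}"
        by (auto simp: \<tau>_def x_def)
      also have "{w \<in> space M. \<forall>k\<le>Suc 0. X (\<tau> k) w = x k} = {w \<in> space M. X 0 w = i \<and> X t w = j}"
        by (auto simp: \<tau>_def x_def le_Suc_eq)
      also have "measure M {w \<in> space M. X 0 w = i \<and> X t w = j} = measure M {w \<in> space M. X t w = j}"
        using X0 X[of 0] X[OF \<open>t \<ge> 0\<close>] by (intro finite_measure_eq_AE) (auto elim: eventually_mono)
      finally show "marginal_law M X t $ j = P 0 t $ i $ j"
        by (simp add: meas0 marginal_law_def \<tau>_def x_def)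
    qed
  qed
  show ?thesis unfolding forward_solution_def
  proof
    fix t assume t: "t \<in> {0..T}"
    have "((\<lambda>r. (P 0 r ** A r) $ i) has_integral (P 0 t - mat 1) $ i) {0..t}"
      using has_integral_linear[OF PI[of t] bounded_linear_vec_nth[of i]] t by (simp add: o_def)
    moreover have "(P 0 t - mat 1) $ i = marginal_law M X t - axis i 1"
      using t by (simp add: law vec_eq_iff mat_def axis_def)
    moreover have "(P 0 r ** A r) $ i = marginal_law M X r v* A r" if "r \<in> {0..t}" for r
      using that by (simp add: law vec_eq_iff matrix_matrix_mult_def vector_matrix_mult_def mult.commute)
    ultimately show "((\<lambda>r. marginal_law M X r v* A r) has_integral marginal_law M X t - axis i 1) {0..t}"
      by (metis (no_types, lifting) has_integral_eq)
  qed
qed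

text \<open>Fubini needs measurability jointly in path and time, while a chain is only known to be
  measurable at each fixed time. Right-continuity makes it a limit of processes that are step
  functions of time.\<close>

lemma borel_measurable_indicator_right_continuous_process:
  assumes X: "\<And>t. t \<ge> 0 \<Longrightarrow> X t \<in> measurable M (count_space UNIV)"
    and rc: "\<And>w t. w \<in> space M \<Longrightarrow> t \<ge> 0 \<Longrightarrow> \<forall>\<^sub>F s in at_right t. X s w = X t w"
  shows "(\<lambda>(w, s). indicator {0..} s * of_bool (X s w = j) :: real) \<in> borel_measurable (M \<Otimes>\<^sub>M (lborel :: real measure))"
proof (rule borel_measurable_LIMSEQ_real)
  \<comment> \<open>Sampling at grid points strictly to the right of \<open>s\<close>, where right-continuity applies.\<close>
  define g :: "nat \<Rightarrow> real \<Rightarrow> real" where "g n s = (real_of_int \<lfloor>real (Suc n) * s\<rfloor> + 1) / real (Suc n)" for n s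
  let ?u = "\<lambda>n (w, s). indicator {0..} s * of_bool (X (g n s) w = j) :: real"
  show "?u n \<in> borel_measurable (M \<Otimes>\<^sub>M (lborel :: real measure))" for n
  proof -
    have k: "(\<lambda>(w, s). \<lfloor>real (Suc n) * s\<rfloor>) \<in> measurable (M \<Otimes>\<^sub>M (lborel :: real measure)) (count_space UNIV)"
      by measurable
    \<comment> \<open>\<open>X\<close> is measurable only at nonnegative times; a negative
      \<open>m\<close> arises only for \<open>s < 0\<close>, where the indicator vanishes.\<close>
    have "(\<lambda>x. indicator {0..} (snd x) *
        (of_bool (0 \<le> m \<and> X ((real_of_int m + 1) / real (Suc n)) (fst x) = j)) :: real)
      \<in> borel_measurable (M \<Otimes>\<^sub>M (lborel :: real measure))" for m :: int
    proof (cases "0 \<le> m")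
      case True
      define Y where "Y = X ((real_of_int m + 1) / real (Suc n))"
      have [measurable]: "Y \<in> measurable M (count_space UNIV)"
        unfolding Y_def using True by (intro X) simp
      have "(\<lambda>x. indicator {0..} (snd x) * (if Y (fst x) = j then 1 else 0) :: real)
        \<in> borel_measurable (M \<Otimes>\<^sub>M (lborel :: real measure))"
        by measurable
      then show ?thesis using True by (simp add: Y_def of_bool_def)
    qed simp
    from measurable_compose_countable[OF this k]
    show ?thesis
      by (rule measurable_cong[THEN iffD1, rotated])
        (auto simp: g_def indicator_def split: if_splits)
  qed
  fix x assume x: "x \<in> space (M \<Otimes>\<^sub>M (lborel :: real measure))"
  obtain w s where ws: "x = (w, s)" "w \<in> space M" using x by (auto simp: space_pair_measure)
  show "(\<lambda>n. ?u n x) \<longlonglongrightarrow> (case x of (w, s) \<Rightarrow> indicator {0..} s * of_bool (X s w = j))"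
  proof (cases "s \<ge> 0")
    case True
    have "(\<lambda>n. g n s) \<longlonglongrightarrow> s"
    proof (rule tendsto_sandwich)
      show "\<forall>\<^sub>F n in sequentially. s \<le> g n s"
        unfolding g_def by (intro always_eventually allI) (simp add: field_simps, linarith)
      show "\<forall>\<^sub>F n in sequentially. g n s \<le> s + 1 / real (Suc n)"
      proof (intro always_eventually allI)
        fix n
        have "real_of_int \<lfloor>real (Suc n) * s\<rfloor> / real (Suc n) \<le> s"
          using of_int_floor_le[of "real (Suc n) * s"]
          by (subst pos_divide_le_eq) (auto simp: mult.commute simp del: of_nat_Suc)
        then show "g n s \<le> s + 1 / real (Suc n)"
          by (simp add: g_def add_divide_distrib del: of_nat_Suc)
      qed
      show "(\<lambda>n. s + 1 / real (Suc n)) \<longlonglongrightarrow> s"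
        using tendsto_add[OF tendsto_const[of s] LIMSEQ_Suc[OF lim_1_over_n]] by simp
    qed simp
    moreover have "g n s > s" for n
      unfolding g_def by (simp add: field_simps, linarith)
    ultimately have "filterlim (\<lambda>n. g n s) (at_right s) sequentially"
      by (simp add: filterlim_at less_imp_neq[symmetric])
    with rc[OF ws(2) True] have "\<forall>\<^sub>F n in sequentially. X (g n s) w = X s w"
      by (rule eventually_compose_filterlim)
    then show ?thesis
      unfolding ws by (auto intro!: tendsto_eventually elim!: eventually_mono simp del: mult_eq_0_iff)
  qed (simp add: ws)
qed

text \<open>After splitting by the current state, only the factors
  \<open>of_bool (X s w = j)\<close> are random, and Fubini replaces them by their expectations.
  Thus a value depends on the marginal laws alone.\<close>

lemma markov_chain_expected_payoff:
  fixes G :: "'d::finite \<Rightarrow> real \<Rightarrow> real"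
  assumes mc: "markov_chain M X A i"
    and G: "\<And>j. set_integrable lborel {0..} (G j)"
  shows "(\<integral>w. (LBINT s:{0..}. G (X s w) s) \<partial>M)
    = (\<Sum>j\<in>UNIV. LBINT s:{0..}. marginal_law M X s $ j * G j s)"
    and "\<And>j. set_integrable lborel {0..} (\<lambda>s. marginal_law M X s $ j * G j s)"
proof -
  interpret prob_space M using mc by (simp add: markov_chain_def)
  interpret L: pair_sigma_finite M "lborel :: real measure" ..
  have X: "X t \<in> measurable M (count_space UNIV)" if "t \<ge> 0" for t
    using mc that by (simp add: markov_chain_def)
  have rc: "\<forall>\<^sub>F s in at_right t. X s w = X t w" if "w \<in> space M" "t \<ge> 0" for w t
    using mc that by (simp add: markov_chain_def)
  let ?G = "\<lambda>j s. indicator {0..} s * G j s"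
  have G': "integrable lborel (?G j)" for j
    using G[of j] by (simp add: set_integrable_def)
  then have [measurable]: "?G j \<in> borel_measurable lborel" for j by (rule borel_measurable_integrable)
  note [measurable] = borel_measurable_indicator_right_continuous_process[OF X rc]
  let ?F = "\<lambda>j w s. (indicator {0..} s * of_bool (X s w = j)) * ?G j s :: real"
  \<comment> \<open>The dominating function drops the random factor; it is integrable on the product
    because \<open>M\<close> has total mass 1.\<close>
  have dom: "integrable (M \<Otimes>\<^sub>M lborel) (\<lambda>(w, s). ?G j s)" for j
  proof -
    show ?thesis
      by (rule L.Fubini_integrable) (use G'[of j] in auto)
  qed
  have int: "integrable (M \<Otimes>\<^sub>M lborel) (\<lambda>(w, s). ?F j w s)" for j
  proof (rule Bochner_Integration.integrable_bound[OF dom[of j]])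
    show "(\<lambda>(w, s). ?F j w s) \<in> borel_measurable (M \<Otimes>\<^sub>M lborel)"
      by measurable
  qed (auto simp: indicator_def)
  have swap: "(\<integral>w. \<integral>s. ?F j w s \<partial>lborel \<partial>M) = (\<integral>s. \<integral>w. ?F j w s \<partial>M \<partial>lborel)" for j
    by (rule L.Fubini_integral[OF int, symmetric])
  have inner: "(\<integral>w. ?F j w s \<partial>M) = indicator {0..} s * (marginal_law M X s $ j * G j s)" for j s
  proof (cases "s \<ge> 0")
    case True
    have "(\<integral>w. of_bool (X s w = j) \<partial>M) = (\<integral>w. indicator {w \<in> space M. X s w = j} w \<partial>M)"
      by (rule Bochner_Integration.integral_cong) (auto simp: indicator_def)
    also have "\<dots> = marginal_law M X s $ j"
      using X[OF True] by (simp add: marginal_law_def)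
    finally have "(\<integral>w. of_bool (X s w = j) \<partial>M) = marginal_law M X s $ j" .
    with True show ?thesis by simp
  qed simp
  show "set_integrable lborel {0..} (\<lambda>s. marginal_law M X s $ j * G j s)" for j
    using L.integrable_snd[OF int[of j]] unfolding inner by (simp add: set_integrable_def)
  have "(\<integral>w. (LBINT s:{0..}. G (X s w) s) \<partial>M) = (\<integral>w. (\<Sum>j\<in>UNIV. \<integral>s. ?F j w s \<partial>lborel) \<partial>M)"
  proof (rule integral_cong_AE)
    \<comment> \<open>Fubini gives integrable sections only for almost every path; the exchange of
      sum and time integral needs them.\<close>
    have "AE w in M. \<forall>j. integrable lborel (\<lambda>s. ?F j w s)"
      using L.AE_integrable_fst[OF int] by (simp add: AE_all_countable)
    then show "AE w in M. (LBINT s:{0..}. G (X s w) s) = (\<Sum>j\<in>UNIV. \<integral>s. ?F j w s \<partial>lborel)"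
    proof eventually_elim
      case (elim w)
      have "(\<Sum>j\<in>UNIV. \<integral>s. ?F j w s \<partial>lborel) = (\<integral>s. (\<Sum>j\<in>UNIV. ?F j w s) \<partial>lborel)"
        using elim by (subst Bochner_Integration.integral_sum) auto
      also have "\<dots> = (LBINT s:{0..}. G (X s w) s)"
        unfolding set_lebesgue_integral_def
      proof (rule Bochner_Integration.integral_cong[OF refl])
        fix s
        have "(\<Sum>j\<in>UNIV. ?F j w s) = (\<Sum>j\<in>UNIV. if j = X s w then indicator {0..} s * G j s else 0)"
          by (rule sum.cong) (auto simp: indicator_def)
        then show "(\<Sum>j\<in>UNIV. ?F j w s) = indicator {0..} s *\<^sub>R G (X s w) s" by simp
      qed
      finally show ?case ..
    qed
    show "(\<lambda>w. \<Sum>j\<in>UNIV. \<integral>s. ?F j w s \<partial>lborel) \<in> borel_measurable M"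
      using L.integrable_fst[OF int] by (intro borel_measurable_sum) auto
    have "(\<lambda>(w, s). (\<Sum>j\<in>UNIV. ?F j w s)) \<in> borel_measurable (M \<Otimes>\<^sub>M lborel)"
      by measurable
    then have "(\<lambda>w. \<integral>s. (\<Sum>j\<in>UNIV. ?F j w s) \<partial>lborel) \<in> borel_measurable M"
      by (rule lborel.borel_measurable_lebesgue_integral)
    moreover have "(\<Sum>j\<in>UNIV. ?F j w s) = indicator {0..} s *\<^sub>R G (X s w) s" for w s
    proof -
      have "(\<Sum>j\<in>UNIV. ?F j w s) = (\<Sum>j\<in>UNIV. if j = X s w then indicator {0..} s * G j s else 0)"
        by (rule sum.cong) (auto simp: indicator_def)
      then show ?thesis by simp
    qed
    ultimately show "(\<lambda>w. LBINT s:{0..}. G (X s w) s) \<in> borel_measurable M"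
      by (simp add: set_lebesgue_integral_def)
  qed
  also have "\<dots> = (\<Sum>j\<in>UNIV. \<integral>w. (\<integral>s. ?F j w s \<partial>lborel) \<partial>M)"
    by (rule Bochner_Integration.integral_sum) (rule L.integrable_fst[OF int])
  also have "\<dots> = (\<Sum>j\<in>UNIV. LBINT s:{0..}. marginal_law M X s $ j * G j s)"
    unfolding swap inner by (simp add: set_lebesgue_integral_def)
  finally show "(\<integral>w. (LBINT s:{0..}. G (X s w) s) \<partial>M)
    = (\<Sum>j\<in>UNIV. LBINT s:{0..}. marginal_law M X s $ j * G j s)" .
qed

section \<open>Entropy and Gibbs densities\<close>

lemma integrable_continuous_on_compact:
  fixes h :: "'a::euclidean_space \<Rightarrow> real"
  assumes "finite_measure \<mu>" "sets \<mu> = sets (restrict_space borel U)" "compact U" "continuous_on U h"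
  shows "integrable \<mu> h"
proof -
  interpret finite_measure \<mu> by fact
  have space: "space \<mu> = U"
    using sets_eq_imp_space_eq[OF assms(2)] by (simp add: space_restrict_space)
  have "compact (h ` U)" using assms by (intro compact_continuous_image)
  then obtain b where b: "\<forall>y\<in>h ` U. norm y \<le> b"
    unfolding bounded_iff[symmetric] by (auto dest!: compact_imp_bounded simp: bounded_iff)
  show ?thesis
  proof (rule integrable_const_bound)
    show "AE x in \<mu>. norm (h x) \<le> b" using b by (intro AE_I2) (simp add: space)
    show "h \<in> borel_measurable \<mu>"
      using borel_measurable_continuous_on_restrict[OF assms(4)] assms(2) by (simp cong: measurable_cong_sets)
  qed
qed

locale action_space =
  fixes U :: "(real ^ 'l::finite) set"
  assumes compact_U: "compact U" and measure_U: "measure lborel U > 0"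
begin

lemma borel_U [measurable, simp]: "U \<in> sets borel"
  using compact_U by (simp add: borel_compact)

lemma space_leb_on [simp]: "space (leb_on U) = U"
  by (simp add: leb_on_def space_restrict_space)

lemma sets_leb_on: "sets (leb_on U) = sets (restrict_space borel U)"
  by (simp add: leb_on_def sets_restrict_space)

lemma emeasure_leb_on: "A \<in> sets borel \<Longrightarrow> A \<subseteq> U \<Longrightarrow> emeasure (leb_on U) A = emeasure lborel A"
  by (simp add: leb_on_def emeasure_restrict_space)

sublocale leb: finite_measure "leb_on U"
proof
  show "emeasure (leb_on U) (space (leb_on U)) \<noteq> \<infinity>"
    using emeasure_bounded_finite[OF compact_imp_bounded[OF compact_U]] by (simp add: emeasure_leb_on)
qed

lemma emeasure_leb_on_finite: "emeasure (leb_on U) A < \<infinity>"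
  using leb.emeasure_finite[of A] by (metis infinity_ennreal_def top.not_eq_extremum)

lemma measure_leb_on: "A \<in> sets borel \<Longrightarrow> A \<subseteq> U \<Longrightarrow> measure (leb_on U) A = measure lborel A"
  by (simp add: measure_def emeasure_leb_on)

lemma nonempty_U: "U \<noteq> {}"
  using measure_U by auto

lemma integrable_leb_on: "continuous_on U h \<Longrightarrow> integrable (leb_on U) (h :: _ \<Rightarrow> real)"
  using integrable_continuous_on_compact[OF leb.finite_measure_axioms sets_leb_on compact_U] .

lemma borel_measurable_leb_on: "continuous_on U h \<Longrightarrow> (h :: _ \<Rightarrow> real) \<in> borel_measurable (leb_on U)"
  by (rule borel_measurable_integrable[OF integrable_leb_on])

lemma prob_densities_onD:
  assumes "\<rho> \<in> prob_densities_on U"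
  shows "\<rho> \<in> borel_measurable (leb_on U)" "\<And>u. u \<in> U \<Longrightarrow> 0 \<le> \<rho> u"
    "AE u in leb_on U. 0 \<le> \<rho> u" "integrable (leb_on U) \<rho>" "(\<integral>u. \<rho> u \<partial>leb_on U) = 1"
proof -
  show *: "\<rho> \<in> borel_measurable (leb_on U)" "\<And>u. u \<in> U \<Longrightarrow> 0 \<le> \<rho> u"
    using assms by (auto simp: prob_densities_on_def)
  then show 1: "AE u in leb_on U. 0 \<le> \<rho> u" by (intro AE_I2) simp
  have 2: "(\<integral>\<^sup>+u. ennreal (\<rho> u) \<partial>leb_on U) = ennreal 1"
    using assms by (auto simp: prob_densities_on_def)
  show "integrable (leb_on U) \<rho>"
    by (rule integrableI_nn_integral_finite[OF *(1) 1 2])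
  show "(\<integral>u. \<rho> u \<partial>leb_on U) = 1"
    using * 1 2 by (subst integral_eq_nn_integral) auto
qed

lemma measure_of_density_in_prob_measures:
  assumes "\<rho> \<in> prob_densities_on U"
  shows "measure_of_density U \<rho> \<in> prob_measures_on U"
proof -
  have "emeasure (measure_of_density U \<rho>) (space (leb_on U)) = (\<integral>\<^sup>+u. ennreal (\<rho> u) \<partial>leb_on U)"
    unfolding measure_of_density_def using prob_densities_onD(1)[OF assms]
    by (subst emeasure_density) (auto intro!: nn_integral_cong simp del: space_leb_on)
  then have "emeasure (measure_of_density U \<rho>) U = 1"
    using assms by (simp add: prob_densities_on_def)
  then show ?thesis
    by (auto simp: prob_measures_on_def measure_of_density_def sets_leb_on intro!: prob_spaceI)
qed

lemma integral_measure_of_density: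
  fixes h :: "real ^ 'l \<Rightarrow> real"
  assumes "\<rho> \<in> prob_densities_on U" "continuous_on U h"
  shows "(\<integral>u. h u \<partial>measure_of_density U \<rho>) = (\<integral>u. \<rho> u * h u \<partial>leb_on U)"
  unfolding measure_of_density_def
  using prob_densities_onD[OF assms(1)] borel_measurable_leb_on[OF assms(2)]
  by (subst integral_density) auto

lemma density_of_measure_of_density:
  assumes "\<rho> \<in> prob_densities_on U"
  shows "AE u in leb_on U. density_of_measure U (measure_of_density U \<rho>) u = \<rho> u"
proof -
  have "AE u in leb_on U. ennreal (\<rho> u) = RN_deriv (leb_on U) (measure_of_density U \<rho>) u"
    using prob_densities_onD(1)[OF assms]
    by (intro leb.RN_deriv_unique) (auto simp: measure_of_density_def)
  with prob_densities_onD(3)[OF assms] show ?thesis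
    by eventually_elim (metis density_of_measure_def enn2real_ennreal)
qed

text \<open>\<open>regularized_value\<close> sees a control only as a measure and recovers its
  density by Radon-Nikodym, hence up to null sets; both integrals in the entropy are insensitive to
  these.\<close>

lemma diff_entropy_density_of_measure:
  assumes "\<rho> \<in> prob_densities_on U"
  shows "diff_entropy U (density_of_measure U (measure_of_density U \<rho>)) = diff_entropy U \<rho>"
proof -
  have *: "(\<integral>\<^sup>+u. F (density_of_measure U (measure_of_density U \<rho>) u) \<partial>leb_on U) = (\<integral>\<^sup>+u. F (\<rho> u) \<partial>leb_on U)"
    for F :: "real \<Rightarrow> ennreal"
    using density_of_measure_of_density[OF assms] by (intro nn_integral_cong_AE) (auto elim: eventually_mono)
  show ?thesis
    unfolding diff_entropy_def *[of "\<lambda>r. ennreal (- (ln r * r))"] *[of "\<lambda>r. ennreal (ln r * r)"] ..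
qed

lemma diff_entropy_eq_integral:
  assumes \<rho>: "\<rho> \<in> prob_densities_on U" and int: "integrable (leb_on U) (\<lambda>u. ln (\<rho> u) * \<rho> u)"
  shows "diff_entropy U \<rho> = ereal (- (\<integral>u. ln (\<rho> u) * \<rho> u \<partial>leb_on U))"
proof -
  define A where "A = (\<integral>\<^sup>+u. ennreal (ln (\<rho> u) * \<rho> u) \<partial>leb_on U)"
  define B where "B = (\<integral>\<^sup>+u. ennreal (- (ln (\<rho> u) * \<rho> u)) \<partial>leb_on U)"
  have "A \<noteq> \<infinity>" "B \<noteq> \<infinity>"
    using int by (auto simp: real_integrable_def A_def B_def)
  then obtain a b where "A = ennreal a" "a \<ge> 0" "B = ennreal b" "b \<ge> 0"
    by (metis ennreal_cases infinity_ennreal_def)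
  moreover have "(\<integral>u. ln (\<rho> u) * \<rho> u \<partial>leb_on U) = enn2real A - enn2real B"
    using real_lebesgue_integral_def[OF int] by (simp add: A_def B_def)
  ultimately show ?thesis
    unfolding diff_entropy_def A_def[symmetric] B_def[symmetric] by simp
qed

text \<open>The bound \<open>- (ln r * r) \<le> 1\<close> controls one part on a space of finite
  measure; an infinite integral of the other part would make the entropy
  \<open>- \<infinity>\<close>.\<close>

lemma regular_density_integrable:
  assumes \<rho>: "\<rho> \<in> prob_densities_on U" and H: "diff_entropy U \<rho> > - \<infinity>"
  shows "integrable (leb_on U) (\<lambda>u. ln (\<rho> u) * \<rho> u)"
proof -
  note [measurable] = prob_densities_onD(1)[OF \<rho>]
  have le: "- (ln r * r) \<le> 1" if "r \<ge> 0" for r :: real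
  proof (cases "r = 0")
    case False
    with that have "r > 0" by simp
    then have "ln (1 / r) * r \<le> (1 / r - 1) * r"
      by (intro mult_right_mono ln_le_minus_one) auto
    also have "\<dots> \<le> 1" using \<open>r > 0\<close> by (simp add: left_diff_distrib)
    finally show ?thesis using \<open>r > 0\<close> by (simp add: ln_div)
  qed simp
  have "(\<integral>\<^sup>+u. ennreal (- (ln (\<rho> u) * \<rho> u)) \<partial>leb_on U) \<le> (\<integral>\<^sup>+u. 1 \<partial>leb_on U)"
    using prob_densities_onD(2)[OF \<rho>] le by (intro nn_integral_mono) simp
  also have "\<dots> < \<infinity>"
    using emeasure_leb_on_finite[of U] by simp
  finally have fin: "(\<integral>\<^sup>+u. ennreal (- (ln (\<rho> u) * \<rho> u)) \<partial>leb_on U) < \<infinity>" .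
  have "(\<integral>\<^sup>+u. ennreal (ln (\<rho> u) * \<rho> u) \<partial>leb_on U) \<noteq> \<infinity>"
  proof
    assume inf: "(\<integral>\<^sup>+u. ennreal (ln (\<rho> u) * \<rho> u) \<partial>leb_on U) = \<infinity>"
    obtain b where "(\<integral>\<^sup>+u. ennreal (- (ln (\<rho> u) * \<rho> u)) \<partial>leb_on U) = ennreal b" "b \<ge> 0"
      by (cases "\<integral>\<^sup>+u. ennreal (- (ln (\<rho> u) * \<rho> u)) \<partial>leb_on U") (use fin in auto)
    then have "diff_entropy U \<rho> = - \<infinity>"
      using inf by (simp add: diff_entropy_def)
    with H show False by simp
  qed
  with fin show ?thesis by (auto simp: real_integrable_def)
qed

section \<open>Gibbs densities and their variational principle\<close>

definition partition_function :: "(real ^ 'l \<Rightarrow> real) \<Rightarrow> real" where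
  "partition_function g = (\<integral>v. exp (g v) \<partial>leb_on U)"

definition gibbs :: "(real ^ 'l \<Rightarrow> real) \<Rightarrow> real ^ 'l \<Rightarrow> real" where
  "gibbs g u = exp (g u) / partition_function g"

text \<open>The integral over \<open>A\<close> alone is a lower bound. \<open>A = U\<close> gives
  positivity; a small ball near a maximizer of \<open>g\<close> gives the entropy estimate.\<close>

lemma partition_function_ge:
  assumes g: "continuous_on U g" and A: "A \<in> sets borel" "A \<subseteq> U" and m: "\<And>u. u \<in> A \<Longrightarrow> m \<le> g u"
  shows "exp m * measure lborel A \<le> partition_function g"
proof -
  have A': "A \<in> sets (leb_on U)"
    using A by (auto simp: sets_leb_on sets_restrict_space)
  have "exp m * measure lborel A = (\<integral>v. indicator A v * exp m \<partial>leb_on U)"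
    using A A' by (simp add: measure_leb_on Int_absorb2)
  also have "\<dots> \<le> partition_function g"
    unfolding partition_function_def
  proof (rule integral_mono)
    show "integrable (leb_on U) (\<lambda>v. indicator A v * exp m)"
      by (intro integrable_mult_left integrable_real_indicator A' emeasure_leb_on_finite)
    show "integrable (leb_on U) (\<lambda>v. exp (g v))"
      by (intro integrable_leb_on continuous_intros g)
  qed (use m in \<open>auto simp: indicator_def\<close>)
  finally show ?thesis .
qed

lemma partition_function_pos:
  assumes "continuous_on U g"
  shows "partition_function g > 0"
proof -
  have "compact (g ` U)" using compact_U assms by (intro compact_continuous_image)
  then obtain m where "\<And>u. u \<in> U \<Longrightarrow> m \<le> g u"
    by (meson bounded_imp_bdd_below bdd_below.E compact_imp_bounded imageI)
  from partition_function_ge[OF assms borel_U order_refl this]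
  show ?thesis using measure_U by (meson exp_gt_zero less_le_trans mult_pos_pos)
qed

lemma continuous_on_gibbs: "continuous_on U g \<Longrightarrow> continuous_on U (gibbs g)"
  unfolding gibbs_def using partition_function_pos[of g] by (intro continuous_intros) auto

lemma gibbs_pos: "continuous_on U g \<Longrightarrow> gibbs g u > 0"
  unfolding gibbs_def using partition_function_pos[of g] by simp

lemma gibbs_in_prob_densities:
  assumes g: "continuous_on U g"
  shows "gibbs g \<in> prob_densities_on U"
proof -
  have "(\<integral>u. gibbs g u \<partial>leb_on U) = 1"
    using partition_function_pos[OF g] by (simp add: gibbs_def partition_function_def)
  then have "(\<integral>\<^sup>+u. ennreal (gibbs g u) \<partial>leb_on U) = 1"
    using gibbs_pos[OF g] integrable_leb_on[OF continuous_on_gibbs[OF g]]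
    by (subst nn_integral_eq_integral) (auto simp: less_imp_le)
  then show ?thesis
    using borel_measurable_leb_on[OF continuous_on_gibbs[OF g]] gibbs_pos[OF g]
    by (auto simp: prob_densities_on_def less_imp_le)
qed

lemma ln_gibbs: "continuous_on U g \<Longrightarrow> ln (gibbs g u) = g u - ln (partition_function g)"
  unfolding gibbs_def using partition_function_pos[of g] by (simp add: ln_div)

lemma diff_entropy_gibbs:
  assumes g: "continuous_on U g"
  shows "diff_entropy U (gibbs g) = ereal (ln (partition_function g) - (\<integral>u. gibbs g u * g u \<partial>leb_on U))"
proof -
  have cont: "continuous_on U (\<lambda>u. gibbs g u * g u)"
    by (intro continuous_intros g continuous_on_gibbs)
  have eq: "ln (gibbs g u) * gibbs g u = gibbs g u * g u - ln (partition_function g) * gibbs g u" for u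
    by (simp add: ln_gibbs[OF g] algebra_simps)
  have int: "integrable (leb_on U) (\<lambda>u. ln (gibbs g u) * gibbs g u)"
    unfolding eq by (intro integrable_leb_on continuous_intros g continuous_on_gibbs)
  have "(\<integral>u. ln (gibbs g u) * gibbs g u \<partial>leb_on U) = (\<integral>u. gibbs g u * g u \<partial>leb_on U) - ln (partition_function g)"
    unfolding eq
    using integrable_leb_on[OF cont] prob_densities_onD(4,5)[OF gibbs_in_prob_densities[OF g]]
    by (subst Bochner_Integration.integral_diff) auto
  then show ?thesis
    using diff_entropy_eq_integral[OF gibbs_in_prob_densities[OF g] int] by simp
qed

text \<open>Gibbs' inequality, that is, the nonnegativity of the relative entropy of
  \<open>\<rho>\<close> with respect to \<open>gibbs g\<close>. It is obtained pointwise from ln x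
  \<le> x - 1 and then integrated.\<close>

lemma gibbs_variational_principle:
  assumes g: "continuous_on U g" and \<rho>: "\<rho> \<in> prob_densities_on U" and H: "diff_entropy U \<rho> > - \<infinity>"
  shows "(\<integral>u. \<rho> u * g u \<partial>leb_on U) + real_of_ereal (diff_entropy U \<rho>) \<le> ln (partition_function g)"
proof -
  let ?Z = "partition_function g"
  have int: "integrable (leb_on U) (\<lambda>u. ln (\<rho> u) * \<rho> u)"
    by (rule regular_density_integrable[OF \<rho> H])
  obtain b where b: "\<And>u. u \<in> U \<Longrightarrow> \<bar>g u\<bar> \<le> b"
    using compact_continuous_image[OF g compact_U]
    by (metis bounded_iff compact_imp_bounded imageI real_norm_def)
  have int_g: "integrable (leb_on U) (\<lambda>u. \<rho> u * g u)"
  proof (rule Bochner_Integration.integrable_bound)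
    show "integrable (leb_on U) (\<lambda>u. b * \<rho> u)"
      using prob_densities_onD(4)[OF \<rho>] by simp
    show "(\<lambda>u. \<rho> u * g u) \<in> borel_measurable (leb_on U)"
      using prob_densities_onD(1)[OF \<rho>] borel_measurable_leb_on[OF g] by measurable
    show "AE u in leb_on U. norm (\<rho> u * g u) \<le> norm (b * \<rho> u)"
    proof (rule AE_I2)
      fix u assume "u \<in> space (leb_on U)"
      then have "u \<in> U" by simp
      have "\<bar>g u\<bar> \<le> \<bar>b\<bar>" using b[OF \<open>u \<in> U\<close>] by linarith
      from mult_left_mono[OF this, of "\<bar>\<rho> u\<bar>"] show "norm (\<rho> u * g u) \<le> norm (b * \<rho> u)"
        by (simp add: abs_mult mult.commute)
    qed
  qed
  have "(\<integral>u. \<rho> u * g u - ln (\<rho> u) * \<rho> u - ln ?Z * \<rho> u \<partial>leb_on U) \<le> (\<integral>u. gibbs g u - \<rho> u \<partial>leb_on U)"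
  proof (rule integral_mono)
    show "integrable (leb_on U) (\<lambda>u. \<rho> u * g u - ln (\<rho> u) * \<rho> u - ln ?Z * \<rho> u)"
      using int int_g prob_densities_onD(4)[OF \<rho>] by auto
    show "integrable (leb_on U) (\<lambda>u. gibbs g u - \<rho> u)"
      using prob_densities_onD(4)[OF \<rho>] prob_densities_onD(4)[OF gibbs_in_prob_densities[OF g]] by auto
    fix u assume "u \<in> space (leb_on U)"
    then have "\<rho> u \<ge> 0" using prob_densities_onD(2)[OF \<rho>] by simp
    show "\<rho> u * g u - ln (\<rho> u) * \<rho> u - ln ?Z * \<rho> u \<le> gibbs g u - \<rho> u"
    \<comment> \<open>Where \<open>\<rho> u = 0\<close> the quotient used below is meaningless;
      there the claim is just that \<open>gibbs g u\<close> is nonnegative.\<close>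
    proof (cases "\<rho> u = 0")
      case False
      with \<open>\<rho> u \<ge> 0\<close> have pos: "\<rho> u > 0" by simp
      have "ln (gibbs g u / \<rho> u) \<le> gibbs g u / \<rho> u - 1"
        using pos gibbs_pos[OF g, of u] by (intro ln_le_minus_one) simp
      then have "\<rho> u * (ln (gibbs g u) - ln (\<rho> u)) \<le> \<rho> u * (gibbs g u / \<rho> u - 1)"
        using pos gibbs_pos[OF g, of u] by (intro mult_left_mono) (simp_all add: ln_div)
      then show ?thesis using pos by (simp add: ln_gibbs[OF g] algebra_simps)
    qed (use gibbs_pos[OF g, of u] in simp)
  qed
  also have "\<dots> = 0"
    using prob_densities_onD(4,5)[OF \<rho>] prob_densities_onD(4,5)[OF gibbs_in_prob_densities[OF g]]
    by (subst Bochner_Integration.integral_diff) auto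
  also have "(\<integral>u. \<rho> u * g u - ln (\<rho> u) * \<rho> u - ln ?Z * \<rho> u \<partial>leb_on U)
      = (\<integral>u. \<rho> u * g u \<partial>leb_on U) - (\<integral>u. ln (\<rho> u) * \<rho> u \<partial>leb_on U) - ln ?Z"
    using int int_g prob_densities_onD(4,5)[OF \<rho>] by simp
  finally show ?thesis
    using diff_entropy_eq_integral[OF \<rho> int] by simp
qed

text \<open>The variational principle with exponent 0, whose partition function is the volume of
  \<open>U\<close>: the uniform density has the largest entropy.\<close>

lemma diff_entropy_gibbs_le:
  assumes g: "continuous_on U g"
  shows "real_of_ereal (diff_entropy U (gibbs g)) \<le> ln (measure lborel U)"
proof -
  have "partition_function (\<lambda>_. 0) = measure lborel U"
    by (simp add: partition_function_def measure_leb_on)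
  with gibbs_variational_principle[OF continuous_on_const gibbs_in_prob_densities[OF g], of 0]
  show ?thesis by (simp add: diff_entropy_gibbs[OF g])
qed

text \<open>The entropy is \<open>ln (partition_function g)\<close> minus the mean of
  \<open>g\<close> under its Gibbs density, and this mean does not exceed \<open>m\<close>.\<close>

lemma diff_entropy_gibbs_ge:
  assumes g: "continuous_on U g" and m: "\<And>u. u \<in> U \<Longrightarrow> g u \<le> m"
  shows "real_of_ereal (diff_entropy U (gibbs g)) \<ge> ln (partition_function g) - m"
proof -
  have "(\<integral>u. gibbs g u * g u \<partial>leb_on U) \<le> (\<integral>u. gibbs g u * m \<partial>leb_on U)"
    using m gibbs_pos[OF g]
    by (intro integral_mono integrable_leb_on continuous_intros g continuous_on_gibbs) (auto simp: less_imp_le)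
  also have "\<dots> = m"
    using prob_densities_onD(5)[OF gibbs_in_prob_densities[OF g]] by simp
  finally show ?thesis by (simp add: diff_entropy_gibbs[OF g])
qed

end

section \<open>The cone condition and the growth of the entropy\<close>

text \<open>The ball sits around the point of height r/2 on the axis.
  \<open>\<kappa> \<le> 1 / 4\<close> keeps heights at least r/4, and
  \<open>\<kappa> \<le> tan \<iota> / 4\<close> keeps the distance from the axis below
  \<open>tan \<iota>\<close> times that height. As cones are scale invariant,
  \<open>\<kappa>\<close> does not depend on \<open>r\<close>.\<close>

lemma standard_cone_contains_ball:
  fixes k :: "'l::finite"
  assumes \<iota>: "0 < \<iota>" "\<iota> \<le> pi / 2" and r: "r > 0"
    and \<kappa>: "\<kappa> \<le> 1 / 4" "\<iota> < pi / 2 \<Longrightarrow> \<kappa> \<le> tan \<iota> / 4"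
    and v: "dist v (axis k (r / 2)) < \<kappa> * r"
  shows "v \<in> standard_cone k \<iota>"
proof -
  define w where "w = v - axis k (r / 2)"
  have w: "norm w < \<kappa> * r" using v by (simp add: w_def dist_norm)
  have "\<kappa> * r > 0" using w norm_ge_zero[of w] by linarith
  have "\<bar>w $ k\<bar> \<le> norm w" by (rule component_le_norm_cart)
  moreover have "\<kappa> * r \<le> 1 / 4 * r" using \<kappa> r by (intro mult_right_mono) auto
  moreover have "v $ k = r / 2 + w $ k" by (simp add: w_def)
  ultimately have vk: "r / 4 \<le> v $ k" using w by linarith
  have "(\<Sum>j\<in>UNIV - {k}. (v $ j)\<^sup>2) \<le> (tan \<iota>)\<^sup>2 * (v $ k)\<^sup>2" if "\<iota> \<noteq> pi / 2"
  proof -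
    have tan: "\<kappa> \<le> tan \<iota> / 4" "tan \<iota> > 0"
      using \<kappa>(2) \<iota> that tan_gt_zero[of \<iota>] by auto
    have "(\<Sum>j\<in>UNIV - {k}. (v $ j)\<^sup>2) = (\<Sum>j\<in>UNIV - {k}. (w $ j)\<^sup>2)"
      by (rule sum.cong) (auto simp: w_def axis_def)
    also have "\<dots> \<le> (\<Sum>j\<in>UNIV. (w $ j)\<^sup>2)"
      by (intro sum_mono2) auto
    also have "\<dots> = (norm w)\<^sup>2"
      unfolding power2_norm_eq_inner inner_vec_def by (simp add: power2_eq_square)
    also have "\<dots> \<le> (\<kappa> * r)\<^sup>2"
      using w by (intro power_mono) auto
    also have "\<dots> \<le> (tan \<iota> * (v $ k))\<^sup>2"
    proof (rule power_mono)
      have "\<kappa> * r \<le> tan \<iota> / 4 * r" using tan r by (intro mult_right_mono) auto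
      also have "\<dots> = tan \<iota> * (r / 4)" by simp
      also have "\<dots> \<le> tan \<iota> * (v $ k)" using tan vk by (intro mult_left_mono) auto
      finally show "\<kappa> * r \<le> tan \<iota> * (v $ k)" .
    qed (use \<open>\<kappa> * r > 0\<close> in simp)
    finally show ?thesis by (simp add: power_mult_distrib)
  qed
  with vk r show ?thesis by (auto simp: standard_cone_def)
qed

text \<open>\<open>R\<close> is an isometry with inverse \<open>transpose R\<close>, so the ball in
  the standard cone can be transported. Height r/2 and radius at most r/4 keep it within distance
  \<open>r\<close> of \<open>u\<close>.\<close>

lemma cone_contains_ball:
  fixes k :: "'l::finite"
  assumes C: "is_cone k u \<iota> C"
    and \<iota>: "0 < \<iota>" "\<iota> \<le> pi / 2" and r: "r > 0"
    and \<kappa>: "\<kappa> \<le> 1 / 4" "\<iota> < pi / 2 \<Longrightarrow> \<kappa> \<le> tan \<iota> / 4"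
  shows "\<exists>c. ball c (\<kappa> * r) \<subseteq> C \<inter> cball u r"
proof -
  obtain R :: "real ^ 'l ^ 'l" where R: "orthogonal_matrix R" "C = (\<lambda>v. u + R *v v) ` standard_cone k \<iota>"
    using C by (auto simp: is_cone_def rotation_matrix_def)
  have "norm (Q *v x) = norm x" if "orthogonal_matrix Q" for Q :: "real ^ 'l ^ 'l" and x
    using that by (intro orthogonal_transformation_norm) (simp add: orthogonal_transformation_matrix)
  then have norm_R: "norm (transpose R *v x) = norm x" "norm (R *v x) = norm x" for x
    using R(1) orthogonal_matrix_transpose[of R] by blast+
  have RR: "R *v (transpose R *v x) = x" "transpose R *v (R *v x) = x" for x
    using R(1) by (auto simp: orthogonal_matrix_def matrix_vector_mul_assoc simp del: transpose_matrix_vector)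
  define c where "c = u + R *v axis k (r / 2)"
  have "x \<in> C \<inter> cball u r" if "x \<in> ball c (\<kappa> * r)" for x
  proof
    have xc: "norm (x - c) < \<kappa> * r" using that by (simp add: dist_norm norm_minus_commute)
    have "transpose R *v (x - u) - axis k (r / 2) = transpose R *v (x - c)"
      by (simp add: c_def matrix_vector_mult_diff_distrib matrix_vector_right_distrib RR
          del: transpose_matrix_vector)
    then have "dist (transpose R *v (x - u)) (axis k (r / 2)) < \<kappa> * r"
      using xc norm_R by (simp add: dist_norm)
    then have "transpose R *v (x - u) \<in> standard_cone k \<iota>"
      by (intro standard_cone_contains_ball[OF \<iota> r \<kappa>])
    then show "x \<in> C" unfolding R(2) by (intro image_eqI[of _ _ "transpose R *v (x - u)"]) (simp add: RR del: transpose_matrix_vector)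
    have "norm (x - u) \<le> norm (x - c) + norm (R *v axis k (r / 2))"
      using norm_triangle_ineq[of "x - c" "c - u"] by (simp add: c_def)
    moreover have "norm (axis k (r / 2) :: real ^ 'l) = r / 2"
      using r by (simp add: norm_eq_sqrt_inner inner_axis_axis real_sqrt_divide)
    then have "norm (R *v axis k (r / 2)) = r / 2" by (simp add: norm_R)
    moreover have "\<kappa> * r \<le> 1 / 4 * r" using \<kappa> r by (intro mult_right_mono) auto
    ultimately have "norm (x - u) \<le> r" using xc r by linarith
    then show "x \<in> cball u r" by (simp add: dist_norm norm_minus_commute)
  qed
  then show ?thesis by blast
qed

text \<open>The one-dimensional counterpart: the centre is at distance r/2 from \<open>u\<close>, on
  the side on which the segment lies in \<open>U\<close>.\<close>

lemma cbox_contains_ball: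
  fixes u :: "real ^ 'l::finite"
  assumes "CARD('l) = 1" "r > 0" "r \<le> \<theta>"
    and "cbox (u - vec \<theta>) u \<subseteq> U \<or> cbox u (u + vec \<theta>) \<subseteq> U"
  shows "\<exists>c. ball c (1 / 4 * r) \<subseteq> U \<inter> cball u r"
proof -
  \<comment> \<open>Both sides at once: \<open>s = 1\<close> gives the box from \<open>u\<close> to
    \<open>u + vec \<theta>\<close>, and \<open>s = - 1\<close> the one from
    \<open>u - vec \<theta>\<close> to \<open>u\<close>.\<close>
  have *: "ball c (1 / 4 * r) \<subseteq> U \<inter> cball u r"
    if s: "s = 1 \<or> s = - 1" "cbox (u + vec ((s - 1) / 2 * \<theta>)) (u + vec ((s + 1) / 2 * \<theta>)) \<subseteq> U" "c = u + vec (s * (r / 2))"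
    for c and s :: real
  proof
    fix x assume "x \<in> ball c (1 / 4 * r)"
    then have "norm (x - c) < 1 / 4 * r" by (simp add: dist_norm norm_minus_commute)
    then have "\<bar>(x - c) $ i\<bar> < 1 / 4 * r" for i
      using component_le_norm_cart[of "x - c" i] by linarith
    then have abs: "\<bar>x $ i - u $ i - s * (r / 2)\<bar> < 1 / 4 * r" for i
      by (simp add: s(3) algebra_simps)
    have x: "s * (r / 2) - 1 / 4 * r < x $ i - u $ i" "x $ i - u $ i < s * (r / 2) + 1 / 4 * r" for i
      using abs[of i] unfolding abs_less_iff by linarith+
    have "u $ i + (s - 1) / 2 * \<theta> \<le> x $ i \<and> x $ i \<le> u $ i + (s + 1) / 2 * \<theta>" for i
      using s(1)
    proof
      assume "s = 1" with x[of i] assms(2,3) show ?thesis by simp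
    next
      assume "s = - 1" with x[of i] assms(2,3) show ?thesis by simp
    qed
    then have "x \<in> U" using s(2) by (auto simp: mem_box_cart)
    \<comment> \<open>There is only one coordinate, so bounding the norm by the sum costs no
      dimensional factor.\<close>
    moreover have "norm (x - u) \<le> (\<Sum>i\<in>UNIV. \<bar>(x - u) $ i\<bar>)" by (rule norm_le_l1_cart)
    moreover have "\<bar>x $ i - u $ i\<bar> \<le> r" for i
      using s(1)
    proof
      assume "s = 1" with x[of i] assms(2) show ?thesis by simp
    next
      assume "s = - 1" with x[of i] assms(2) show ?thesis by simp
    qed
    then have "(\<Sum>i\<in>UNIV. \<bar>(x - u) $ i\<bar>) \<le> (\<Sum>i\<in>(UNIV :: 'l set). r)"
      by (intro sum_mono) simp
    ultimately show "x \<in> U \<inter> cball u r" using assms(1) by (simp add: dist_norm norm_minus_commute)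
  qed
  have "vec 0 = (0 :: real ^ 'l)" "vec (- \<theta>) = - (vec \<theta> :: real ^ 'l)"
    by (simp_all add: vec_eq_iff)
  with assms(4) *[of 1 "u + vec (1 * (r / 2))"] *[of "- 1" "u + vec (- 1 * (r / 2))"]
  have "ball (u + vec (1 * (r / 2))) (1 / 4 * r) \<subseteq> U \<inter> cball u r \<or>
      ball (u + vec (- 1 * (r / 2))) (1 / 4 * r) \<subseteq> U \<inter> cball u r"
    by (simp, blast)
  then show ?thesis by blast
qed

text \<open>The form in which the cone condition enters the entropy estimate: at every point and
  every small scale \<open>r\<close>, \<open>U\<close> contains a nearby ball of radius proportional
  to \<open>r\<close>, with the same proportion for all points.\<close>

lemma uniform_cone_condition_balls:
  assumes "uniform_cone_condition (k :: 'l::finite) U"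
  obtains \<kappa> \<theta> :: real where "\<kappa> > 0" "\<theta> > 0"
    "\<And>u r. u \<in> U \<Longrightarrow> 0 < r \<Longrightarrow> r \<le> \<theta> \<Longrightarrow> \<exists>c. ball c (\<kappa> * r) \<subseteq> U \<inter> cball u r"
proof (cases "CARD('l) = 1")
  case True
  then obtain \<theta> :: real where "\<theta> > 0" "\<forall>u\<in>U. cbox (u - vec \<theta>) u \<subseteq> U \<or> cbox u (u + vec \<theta>) \<subseteq> U"
    using assms by (auto simp: uniform_cone_condition_def)
  then show thesis
    using cbox_contains_ball[OF True] by (intro that[of "1 / 4" \<theta>]) auto
next
  case False
  then obtain \<theta> \<iota> :: real where \<theta>: "\<theta> > 0" and \<iota>: "0 < \<iota>" "\<iota> \<le> pi / 2"
    and C: "\<forall>u\<in>U. \<exists>C. is_cone k u \<iota> C \<and> C \<inter> ball u \<theta> \<subseteq> U"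
    using assms by (auto simp: uniform_cone_condition_def)
  \<comment> \<open>In HOL \<open>tan (pi / 2)\<close> is 0, so the half-space needs its own
    positive value.\<close>
  define \<kappa> where "\<kappa> = (if \<iota> = pi / 2 then 1 / 4 else min (1 / 4) (tan \<iota> / 4))"
  have \<kappa>: "\<kappa> > 0" "\<kappa> \<le> 1 / 4" "\<iota> < pi / 2 \<Longrightarrow> \<kappa> \<le> tan \<iota> / 4"
    using \<iota> tan_gt_zero[of \<iota>] by (auto simp: \<kappa>_def)
  show thesis
  \<comment> \<open>Half of \<open>\<theta>\<close>, so that the closed ball
    \<open>cball u r\<close> fits into the open ball \<open>ball u \<theta>\<close>.\<close>
  proof (rule that[of \<kappa> "\<theta> / 2"])
    fix u r assume u: "u \<in> U" and r: "0 < r" "r \<le> \<theta> / 2"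
    obtain C where "is_cone k u \<iota> C" "C \<inter> ball u \<theta> \<subseteq> U" using C u by blast
    moreover obtain c where "ball c (\<kappa> * r) \<subseteq> C \<inter> cball u r"
      using cone_contains_ball[OF \<open>is_cone k u \<iota> C\<close> \<iota> r(1) \<kappa>(2,3)] by blast
    moreover have "cball u r \<subseteq> ball u \<theta>" using r \<theta> by auto
    ultimately show "\<exists>c. ball c (\<kappa> * r) \<subseteq> U \<inter> cball u r" by blast
  qed (use \<kappa> \<theta> in auto)
qed

text \<open>Uniform continuity on the compact product makes the integrands uniformly close. The
  parameter is used both for the time and for the vector in the Gibbs exponent.\<close>

lemma continuous_on_integral_param:
  fixes \<phi> :: "'b::metric_space \<Rightarrow> 'a::euclidean_space \<Rightarrow> real"
  assumes \<mu>: "finite_measure \<mu>" "sets \<mu> = sets (restrict_space borel U)"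
    and "compact U" "compact K" and cont: "continuous_on (K \<times> U) (\<lambda>(y, u). \<phi> y u)"
  shows "continuous_on K (\<lambda>y. \<integral>u. \<phi> y u \<partial>\<mu>)"
  unfolding continuous_on_iff
proof (intro ballI allI impI)
  fix y and e :: real assume y: "y \<in> K" and e: "0 < e"
  interpret finite_measure \<mu> by fact
  have space: "space \<mu> = U"
    using sets_eq_imp_space_eq[OF \<mu>(2)] by (simp add: space_restrict_space)
  have int: "integrable \<mu> (\<phi> y)" if "y \<in> K" for y
  proof (rule integrable_continuous_on_compact[OF \<mu> \<open>compact U\<close>])
    have "continuous_on U ((\<lambda>(y, u). \<phi> y u) \<circ> (\<lambda>u. (y, u)))"
      by (rule continuous_on_compose) (auto intro!: continuous_intros continuous_on_subset[OF cont] simp: that)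
    then show "continuous_on U (\<phi> y)" by (simp add: o_def)
  qed
  define m where "m = measure \<mu> U"
  have "uniformly_continuous_on (K \<times> U) (\<lambda>(y, u). \<phi> y u)"
    using assms by (intro compact_uniformly_continuous compact_Times)
  \<comment> \<open>Dividing by \<open>m + 1\<close> covers total mass 0 and leaves room for the
    strict inequality.\<close>
  moreover have e': "e / (m + 1) > 0" using e by (simp add: m_def add_nonneg_pos)
  ultimately obtain d where d: "d > 0"
    "\<And>z z'. z \<in> K \<times> U \<Longrightarrow> z' \<in> K \<times> U \<Longrightarrow> dist z' z < d \<Longrightarrow>
      dist ((\<lambda>(y, u). \<phi> y u) z') ((\<lambda>(y, u). \<phi> y u) z) < e / (m + 1)"
    unfolding uniformly_continuous_on_def by metis
  show "\<exists>d>0. \<forall>y'\<in>K. dist y' y < d \<longrightarrow> dist (\<integral>u. \<phi> y' u \<partial>\<mu>) (\<integral>u. \<phi> y u \<partial>\<mu>) < e"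
  proof (intro exI[of _ d] conjI ballI impI)
    fix y' assume y': "y' \<in> K" "dist y' y < d"
    have le: "\<bar>\<phi> y' u - \<phi> y u\<bar> \<le> e / (m + 1)" if "u \<in> U" for u
      using d(2)[of "(y, u)" "(y', u)"] y y' that by (auto simp: dist_Pair_Pair dist_real_def)
    have "\<bar>\<integral>u. \<phi> y' u - \<phi> y u \<partial>\<mu>\<bar> \<le> (\<integral>u. \<bar>\<phi> y' u - \<phi> y u\<bar> \<partial>\<mu>)"
      by (rule integral_abs_bound)
    also have "\<dots> \<le> (\<integral>u. e / (m + 1) \<partial>\<mu>)"
      using int y y' le by (intro integral_mono) (auto simp: space)
    also have "\<dots> = m * (e / (m + 1))" by (simp add: m_def space)
    also have "\<dots> < e" using e by (simp add: m_def field_simps add_pos_nonneg add_nonneg_pos)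
    finally show "dist (\<integral>u. \<phi> y' u \<partial>\<mu>) (\<integral>u. \<phi> y u \<partial>\<mu>) < e"
      using int y y' by (simp add: dist_real_def)
  qed (rule d)
qed

context action_space
begin

text \<open>\<open>b\<close> depends on \<open>U\<close> alone. The upper bound is a constant, so
  only the lower one involves \<open>K\<close>: the log partition function minus the maximum of
  \<open>g\<close> is at least the log volume of a ball on which \<open>g\<close> is within 1 of its
  maximum, minus 1.\<close>

lemma gibbs_entropy_log_bound:
  assumes "uniform_cone_condition k U"
  obtains b where "b \<ge> 0"
    "\<And>g K. K \<ge> 0 \<Longrightarrow> (\<And>u v. u \<in> U \<Longrightarrow> v \<in> U \<Longrightarrow> \<bar>g u - g v\<bar> \<le> K * norm (u - v)) \<Longrightarrow>
      \<bar>real_of_ereal (diff_entropy U (gibbs g))\<bar> \<le> b + real CARD('l) * ln (1 + K)"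
proof -
  obtain \<kappa> \<theta> :: real where \<kappa>: "\<kappa> > 0" and \<theta>: "\<theta> > 0"
    and ball: "\<And>u r. u \<in> U \<Longrightarrow> 0 < r \<Longrightarrow> r \<le> \<theta> \<Longrightarrow> \<exists>c. ball c (\<kappa> * r) \<subseteq> U \<inter> cball u r"
    using uniform_cone_condition_balls[OF assms] by metis
  define n where "n = real CARD('l)"
  define V where "V = measure lborel (ball (0 :: real ^ 'l) 1)"
  have V: "V > 0" unfolding V_def using content_ball_pos[of 1 "0 :: real ^ 'l"] by simp
  \<comment> \<open>The constants of the upper and the lower bound added up in absolute value, so
    that one number covers both.\<close>
  define b where "b = \<bar>ln (measure lborel U)\<bar> + 1 + \<bar>ln V\<bar> + n * \<bar>ln \<kappa>\<bar> + n * \<bar>ln \<theta>\<bar>"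
  have n: "n \<ge> 0" by (simp add: n_def)
  have b: "b \<ge> 0" using n by (simp add: b_def)
  show thesis
  proof (rule that[OF b])
    fix g and K :: real
    assume K: "K \<ge> 0" and lip: "\<And>u v. u \<in> U \<Longrightarrow> v \<in> U \<Longrightarrow> \<bar>g u - g v\<bar> \<le> K * norm (u - v)"
    have "K-lipschitz_on U g"
      using K lip by (auto intro!: lipschitz_onI simp: dist_norm)
    then have g: "continuous_on U g" by (rule lipschitz_on_continuous_on)
    obtain u0 where u0: "u0 \<in> U" "\<And>u. u \<in> U \<Longrightarrow> g u \<le> g u0"
      using continuous_attains_sup[OF compact_U nonempty_U g] by blast
    \<comment> \<open>Scales up to \<open>\<theta>\<close> are where balls are available;
      \<open>1 / (1 + K)\<close> makes \<open>K * r \<le> 1\<close>, so that \<open>g\<close> drops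
      by at most 1.\<close>
    define r where "r = min \<theta> (1 / (1 + K))"
    have r: "0 < r" "r \<le> \<theta>" "K * r \<le> 1"
    proof -
      have "K * r \<le> K * (1 / (1 + K))" using K by (intro mult_left_mono) (auto simp: r_def)
      also have "\<dots> \<le> 1" using K by simp
      finally show "K * r \<le> 1" .
    qed (use \<theta> K in \<open>auto simp: r_def\<close>)
    obtain c where c: "ball c (\<kappa> * r) \<subseteq> U \<inter> cball u0 r" using ball[OF u0(1) r(1,2)] by blast
    have "g u0 - 1 \<le> g u" if "u \<in> ball c (\<kappa> * r)" for u
    proof -
      have u: "u \<in> U" "norm (u0 - u) \<le> r" using that c by (auto simp: dist_norm)
      have "\<bar>g u0 - g u\<bar> \<le> K * norm (u0 - u)" using lip u u0 by blast
      also have "\<dots> \<le> K * r" using K u by (intro mult_left_mono)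
      finally show ?thesis using r by linarith
    qed
    then have "exp (g u0 - 1) * measure lborel (ball c (\<kappa> * r)) \<le> partition_function g"
      using c by (intro partition_function_ge[OF g]) auto
    also have "measure lborel (ball c (\<kappa> * r)) = (\<kappa> * r) ^ CARD('l) * V"
      using content_ball_conv_unit_ball[of "\<kappa> * r" c] \<kappa> r by (simp add: V_def)
    finally have "ln (exp (g u0 - 1) * ((\<kappa> * r) ^ CARD('l) * V)) \<le> ln (partition_function g)"
      using \<kappa> r V partition_function_pos[OF g] by simp
    moreover have "ln (exp (g u0 - 1) * ((\<kappa> * r) ^ CARD('l) * V)) = g u0 - 1 + (n * (ln \<kappa> + ln r) + ln V)"
      using \<kappa> r V by (simp add: ln_mult ln_realpow n_def)
    ultimately have low: "real_of_ereal (diff_entropy U (gibbs g)) \<ge> - 1 + n * ln \<kappa> + n * ln r + ln V"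
      using diff_entropy_gibbs_ge[OF g, of "g u0"] u0 by (simp add: algebra_simps)
    have "- \<bar>ln \<theta>\<bar> - ln (1 + K) \<le> ln r"
    proof (cases "\<theta> \<le> 1 / (1 + K)")
      case True
      moreover have "ln (1 + K) \<ge> 0" using K by simp
      ultimately show ?thesis by (simp add: r_def)
    next
      case False
      then have "ln r = - ln (1 + K)" using K by (simp add: r_def ln_div)
      then show ?thesis by simp
    qed
    from mult_left_mono[OF this n] have "- n * \<bar>ln \<theta>\<bar> - n * ln (1 + K) \<le> n * ln r"
      by (simp add: algebra_simps)
    moreover have "- n * \<bar>ln \<kappa>\<bar> \<le> n * ln \<kappa>"
      using mult_left_mono[OF _ n, of "- \<bar>ln \<kappa>\<bar>" "ln \<kappa>"] by simp
    moreover have "n * \<bar>ln \<theta>\<bar> \<ge> 0" "n * \<bar>ln \<kappa>\<bar> \<ge> 0" "n * ln (1 + K) \<ge> 0"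
      using n K by auto
    ultimately show "\<bar>real_of_ereal (diff_entropy U (gibbs g))\<bar> \<le> b + real CARD('l) * ln (1 + K)"
      using low diff_entropy_gibbs_le[OF g] unfolding b_def n_def[symmetric] by linarith
  qed
qed

end

text \<open>A logarithm is eventually below the identity; \<open>R\<close> becomes the radius of the
  ball to which Brouwer's theorem is applied.\<close>

lemma sublinear_log_growth:
  fixes a b c :: real
  assumes "c > 0"
  obtains R where "R > 0" "a + b * ln (1 + c * (1 + R)) \<le> R"
proof -
  have "((\<lambda>R. (a + b * ln (1 + c * (1 + R))) / R) \<longlongrightarrow> 0) at_top"
    using assms by real_asymp
  then have "\<forall>\<^sub>F R in at_top. (a + b * ln (1 + c * (1 + R))) / R < 1"
    by (rule order_tendstoD) simp
  moreover have "\<forall>\<^sub>F R in at_top. (0::real) < R"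
    by (rule eventually_gt_at_top)
  ultimately have "\<forall>\<^sub>F R in at_top. R > 0 \<and> a + b * ln (1 + c * (1 + R)) \<le> R"
    by eventually_elim (auto simp: field_simps)
  then show thesis using that eventually_happens'[OF trivial_limit_at_top_linorder] by blast
qed

section \<open>The Lipschitz constant and an integrable envelope\<close>

text \<open>The index set may be uncountable: the supremum is lower semicontinuous on \<open>S\<close>.\<close>

lemma borel_measurable_SUP_continuous_on:
  fixes g :: "'i \<Rightarrow> 'a::topological_space \<Rightarrow> ennreal"
  assumes "S \<in> sets borel" "\<And>i. i \<in> I \<Longrightarrow> continuous_on S (g i)"
  shows "(\<lambda>s. (SUP i\<in>I. g i s) * indicator S s) \<in> borel_measurable borel"
proof (rule borel_measurableI_greater)
  fix a :: ennreal
  have "\<exists>T. open T \<and> T \<inter> S = g i -` {a<..} \<inter> S" if "i \<in> I" for i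
    using assms(2)[OF that] by (metis continuous_on_open_invariant open_greaterThan)
  then obtain T where T: "\<And>i. i \<in> I \<Longrightarrow> open (T i) \<and> T i \<inter> S = g i -` {a<..} \<inter> S"
    by metis
  have "{s \<in> space borel. a < (SUP i\<in>I. g i s) * indicator S s} = (\<Union>i\<in>I. T i) \<inter> S"
  proof (intro set_eqI iffI)
    fix s assume "s \<in> {s \<in> space borel. a < (SUP i\<in>I. g i s) * indicator S s}"
    then have *: "a < (SUP i\<in>I. g i s) * indicator S s" by simp
    then have s: "s \<in> S" by (intro ccontr[of "s \<in> S"]) simp
    with * obtain i where "i \<in> I" "a < g i s" by (auto simp: less_SUP_iff)
    with s T[of i] show "s \<in> (\<Union>i\<in>I. T i) \<inter> S" by blast
  next
    fix s assume "s \<in> (\<Union>i\<in>I. T i) \<inter> S"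
    then obtain i where i: "i \<in> I" "s \<in> T i" "s \<in> S" by blast
    with T[of i] have "a < g i s" by blast
    with i show "s \<in> {s \<in> space borel. a < (SUP i\<in>I. g i s) * indicator S s}"
      by (auto simp: less_SUP_iff)
  qed
  moreover have "open (\<Union>i\<in>I. T i)" using T by (intro open_UN) blast
  ultimately show "{s \<in> space borel. a < (SUP i\<in>I. g i s) * indicator S s} \<in> sets borel"
    using assms(1) by simp
qed

text \<open>Both quotients are nonnegative, so each is below their sum and hence below the supremum.
  As \<open>q\<close> carries no time, its bound is read off at time 0.\<close>

lemma ennreal_SUP_lipschitz_bound:
  fixes f :: "real \<Rightarrow> 'd::finite \<Rightarrow> 'a::real_normed_vector \<Rightarrow> real" and q :: "'a \<Rightarrow> ('b::real_normed_vector) ^ 'd"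
  assumes "(SUP t\<in>{0..}. SUP i. SUP u\<^sub>1\<in>U. SUP u\<^sub>2\<in>U - {u\<^sub>1}.
        ennreal (\<bar>f t i u\<^sub>1 - f t i u\<^sub>2\<bar> / norm (u\<^sub>1 - u\<^sub>2)
          + norm (q u\<^sub>1 $ i - q u\<^sub>2 $ i) / norm (u\<^sub>1 - u\<^sub>2))) < \<infinity>"
  obtains L where "L \<ge> 0"
    "\<And>t i u v. t \<ge> 0 \<Longrightarrow> u \<in> U \<Longrightarrow> v \<in> U \<Longrightarrow> \<bar>f t i u - f t i v\<bar> \<le> L * norm (u - v)"
    "\<And>i u v. u \<in> U \<Longrightarrow> v \<in> U \<Longrightarrow> norm (q u $ i - q v $ i) \<le> L * norm (u - v)"
proof -
  define S where "S = (SUP t\<in>{0..}. SUP i. SUP u\<^sub>1\<in>U. SUP u\<^sub>2\<in>U - {u\<^sub>1}.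
        ennreal (\<bar>f t i u\<^sub>1 - f t i u\<^sub>2\<bar> / norm (u\<^sub>1 - u\<^sub>2)
          + norm (q u\<^sub>1 $ i - q u\<^sub>2 $ i) / norm (u\<^sub>1 - u\<^sub>2)))"
  have S: "S = ennreal (enn2real S)" using assms by (simp add: S_def less_top)
  have le: "\<bar>f t i u - f t i v\<bar> + norm (q u $ i - q v $ i) \<le> enn2real S * norm (u - v)"
    if "t \<ge> 0" "u \<in> U" "v \<in> U" for t i u v
  proof (cases "u = v")
    case False
    let ?x = "\<bar>f t i u - f t i v\<bar> / norm (u - v) + norm (q u $ i - q v $ i) / norm (u - v)"
    have "ennreal ?x \<le> S"
      unfolding S_def using that False
      by (intro SUP_upper2[of t] SUP_upper2[of i] SUP_upper2[of u] SUP_upper2[of v]) auto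
    also note S
    finally have "?x \<le> enn2real S" by (simp del: ennreal_plus)
    then have "?x * norm (u - v) \<le> enn2real S * norm (u - v)" by (rule mult_right_mono) simp
    with False show ?thesis by (simp add: distrib_right)
  qed simp
  show thesis
  proof (rule that[of "enn2real S"])
    show "\<bar>f t i u - f t i v\<bar> \<le> enn2real S * norm (u - v)" if "t \<ge> 0" "u \<in> U" "v \<in> U" for t i u v
      using le[OF that, of i] norm_ge_zero[of "q u $ i - q v $ i"] by linarith
    show "norm (q u $ i - q v $ i) \<le> enn2real S * norm (u - v)" if "u \<in> U" "v \<in> U" for i u v
      using le[OF order_refl that, of i] abs_ge_zero[of "f 0 i u - f 0 i v"] by linarith
  qed simp
qed

text \<open>\<open>E\<close> is the supremum of the rewards turned into a real function; continuity
  in time makes it measurable.\<close>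

lemma integrable_envelope:
  fixes f :: "real \<Rightarrow> 'd::finite \<Rightarrow> 'a::real_normed_vector \<Rightarrow> real" and \<delta> :: "real \<Rightarrow> real"
  assumes M: "(\<integral>\<^sup>+s\<in>{0..}. ((SUP i. SUP u\<in>U. ennreal \<bar>f s i u\<bar>) + ennreal (\<delta> s)) \<partial>lborel) < \<infinity>"
    and cont: "\<And>i u. u \<in> U \<Longrightarrow> continuous_on {0..} (\<lambda>t. f t i u)" "continuous_on {0..} \<delta>"
    and \<delta>: "\<And>t. t \<ge> 0 \<Longrightarrow> \<delta> t \<ge> 0"
    and lip: "\<And>t i u v. t \<ge> 0 \<Longrightarrow> u \<in> U \<Longrightarrow> v \<in> U \<Longrightarrow> \<bar>f t i u - f t i v\<bar> \<le> L * norm (u - v)"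
    and U: "bounded U" "U \<noteq> {}" and L: "L \<ge> 0"
  obtains E where "set_integrable lborel {0..} E" "set_integrable lborel {0..} \<delta>"
    "\<And>t i u. t \<ge> 0 \<Longrightarrow> u \<in> U \<Longrightarrow> \<bar>f t i u\<bar> \<le> E t"
proof -
  define F where "F s = (SUP i. SUP u\<in>U. ennreal \<bar>f s i u\<bar>)" for s
  \<comment> \<open>One supremum over pairs is the shape required for the measurability of suprema
    of continuous functions.\<close>
  have F_eq: "F s = (SUP z\<in>UNIV \<times> U. ennreal \<bar>f s (fst z) (snd z)\<bar>)" for s
    unfolding F_def
  proof (rule antisym)
    show "(SUP i. SUP u\<in>U. ennreal \<bar>f s i u\<bar>) \<le> (SUP z\<in>UNIV \<times> U. ennreal \<bar>f s (fst z) (snd z)\<bar>)"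
      by (intro SUP_least, rule SUP_upper2[of "(_, _)"]) auto
    show "(SUP z\<in>UNIV \<times> U. ennreal \<bar>f s (fst z) (snd z)\<bar>) \<le> (SUP i. SUP u\<in>U. ennreal \<bar>f s i u\<bar>)"
    proof (rule SUP_least)
      fix z assume "z \<in> (UNIV :: 'd set) \<times> U"
      then show "ennreal \<bar>f s (fst z) (snd z)\<bar> \<le> (SUP i. SUP u\<in>U. ennreal \<bar>f s i u\<bar>)"
        by (intro SUP_upper2[of "fst z"] SUP_upper2[of "snd z"]) auto
    qed
  qed
  \<comment> \<open>A finite integral gives finiteness only almost everywhere, but the bound is
    wanted at every time. It comes from the Lipschitz condition around one point of the bounded set
    \<open>U\<close>.\<close>
  have fin: "F s < \<infinity>" if "s \<ge> 0" for s
  proof -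
    obtain u0 where u0: "u0 \<in> U" using U by blast
    obtain r where r: "\<And>u. u \<in> U \<Longrightarrow> norm (u - u0) \<le> r"
      using bounded_any_center[of U u0] U(1) by (auto simp: dist_norm norm_minus_commute)
    define m where "m = Max (range (\<lambda>i. \<bar>f s i u0\<bar>)) + L * r"
    have "\<bar>f s i u\<bar> \<le> m" if "u \<in> U" for i u
    proof -
      have "\<bar>f s i u - f s i u0\<bar> \<le> L * norm (u - u0)" by (rule lip) fact+
      also have "\<dots> \<le> L * r" using r[OF that] L by (rule mult_left_mono)
      finally have "\<bar>f s i u\<bar> \<le> \<bar>f s i u0\<bar> + L * r" by linarith
      also have "\<bar>f s i u0\<bar> \<le> Max (range (\<lambda>i. \<bar>f s i u0\<bar>))" by (rule Max_ge) auto
      finally show ?thesis by (simp add: m_def)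
    qed
    then have "F s \<le> ennreal m"
      unfolding F_def by (intro SUP_least ennreal_leI) auto
    then show ?thesis using ennreal_less_top le_less_trans infinity_ennreal_def by metis
  qed
  have cont': "continuous_on {0..} (\<lambda>s. ennreal \<bar>f s i u\<bar>)" if "u \<in> U" for i u
    by (intro continuous_on_ennreal continuous_intros cont that)
  have meas: "(\<lambda>s. F s * indicator {0..} s) \<in> borel_measurable borel"
    unfolding F_eq by (rule borel_measurable_SUP_continuous_on) (auto intro: cont')
  have eq: "ennreal (norm (indicator {0..} s *\<^sub>R enn2real (F s))) = F s * indicator {0..} s" for s :: real
    using fin[of s] by (auto simp: indicator_def less_top)
  have "set_integrable lborel {0..} (\<lambda>s. enn2real (F s))"
    unfolding set_integrable_def
  proof (rule integrableI_bounded)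
    have "(\<lambda>s. enn2real (F s * indicator {0..} s)) \<in> borel_measurable borel"
      using meas by measurable
    moreover have "enn2real (F s * indicator {0..} s) = indicator {0..} s *\<^sub>R enn2real (F s)" for s :: real
      by (simp add: indicator_def)
    ultimately show "(\<lambda>s. indicator {0..} s *\<^sub>R enn2real (F s)) \<in> borel_measurable lborel" by simp
    have "(\<integral>\<^sup>+s. ennreal (norm (indicator {0..} s *\<^sub>R enn2real (F s))) \<partial>lborel)
        \<le> (\<integral>\<^sup>+s\<in>{0..}. (F s + ennreal (\<delta> s)) \<partial>lborel)"
      unfolding eq by (intro nn_integral_mono mult_right_mono) auto
    also have "\<dots> < \<infinity>" using M unfolding F_def .
    finally show "(\<integral>\<^sup>+s. ennreal (norm (indicator {0..} s *\<^sub>R enn2real (F s))) \<partial>lborel) < \<infinity>" .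
  qed
  moreover have "set_integrable lborel {0..} \<delta>"
    unfolding set_integrable_def
  proof (rule integrableI_bounded)
    show "(\<lambda>s. indicator {0..} s *\<^sub>R \<delta> s) \<in> borel_measurable lborel"
      using borel_measurable_continuous_on_indicator[OF _ cont(2)] by simp
    have "(\<integral>\<^sup>+s. ennreal (norm (indicator {0..} s *\<^sub>R \<delta> s)) \<partial>lborel)
        \<le> (\<integral>\<^sup>+s\<in>{0..}. (F s + ennreal (\<delta> s)) \<partial>lborel)"
      using \<delta> by (intro nn_integral_mono) (auto simp: indicator_def)
    also have "\<dots> < \<infinity>" using M unfolding F_def .
    finally show "(\<integral>\<^sup>+s. ennreal (norm (indicator {0..} s *\<^sub>R \<delta> s)) \<partial>lborel) < \<infinity>" .
  qed
  moreover have "\<bar>f t i u\<bar> \<le> enn2real (F t)" if "t \<ge> 0" "u \<in> U" for t i u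
  proof -
    have "ennreal \<bar>f t i u\<bar> \<le> F t"
      unfolding F_def using that by (intro SUP_upper2[of i] SUP_upper2[of u]) auto
    also have "F t = ennreal (enn2real (F t))" using fin[OF that(1)] by (simp add: less_top)
    finally show ?thesis by (simp add: ennreal_le_iff)
  qed
  ultimately show thesis by (rule that)
qed

section \<open>Value functions\<close>

text \<open>The two suprema of the theorem are represented here by a Lipschitz constant
  \<open>L\<close> and an integrable envelope \<open>E\<close>.\<close>

locale control_problem = action_space U for U :: "(real ^ 'l::finite) set" +
  fixes q :: "real ^ 'l \<Rightarrow> real ^ 'd ^ 'd::finite"
    and f :: "real \<Rightarrow> 'd \<Rightarrow> real ^ 'l \<Rightarrow> real"
    and \<delta> :: "real \<Rightarrow> real"
    and Pr :: "('d, 'l) policy \<Rightarrow> 'd \<Rightarrow> 'w measure"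
    and X :: "('d, 'l) policy \<Rightarrow> real \<Rightarrow> 'w \<Rightarrow> 'd"
    and lam :: real and L :: real and E :: "real \<Rightarrow> real"
  assumes chains: "controlled_chains U q Pr X"
    and L: "L \<ge> 0"
    and f_lipschitz: "\<And>t i u v. t \<ge> 0 \<Longrightarrow> u \<in> U \<Longrightarrow> v \<in> U \<Longrightarrow> \<bar>f t i u - f t i v\<bar> \<le> L * norm (u - v)"
    and q_lipschitz: "\<And>i u v. u \<in> U \<Longrightarrow> v \<in> U \<Longrightarrow> norm (q u $ i - q v $ i) \<le> L * norm (u - v)"
    and f_continuous: "\<And>i u. u \<in> U \<Longrightarrow> continuous_on {0..} (\<lambda>t. f t i u)"
    and f_le: "\<And>t i u. t \<ge> 0 \<Longrightarrow> u \<in> U \<Longrightarrow> \<bar>f t i u\<bar> \<le> E t"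
    and E_integrable: "set_integrable lborel {0..} E"
    and \<delta>_integrable: "set_integrable lborel {0..} \<delta>"
    and \<delta>_nonneg: "\<And>t. t \<ge> 0 \<Longrightarrow> \<delta> t \<ge> 0" and \<delta>_0: "\<delta> 0 = 1"
    and \<delta>_continuous: "continuous_on {0..} \<delta>"
    and lam: "lam > 0"
begin

text \<open>Real-valued because regular controls have finite entropy; \<open>real_of_ereal\<close>
  would send \<open>- \<infinity>\<close> to 0.\<close>

definition entropy_of :: "('d, 'l) control \<Rightarrow> 'd \<Rightarrow> real" where
  "entropy_of \<pi> j = real_of_ereal (diff_entropy U (density_of_measure U (\<pi> j)))"

definition reward :: "('d, 'l) control \<Rightarrow> 'd \<Rightarrow> real \<Rightarrow> real" where
  "reward \<pi> j s = averaged_reward f (\<pi> j) s j + lam * \<delta> s * entropy_of \<pi> j"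

definition law :: "('d, 'l) control \<Rightarrow> 'd \<Rightarrow> real \<Rightarrow> real ^ 'd" where
  "law \<pi> i = marginal_law (Pr (\<lambda>_. \<pi>) i) (X (\<lambda>_. \<pi>))"

abbreviation V :: "('d, 'l) policy \<Rightarrow> real ^ 'd" where
  "V \<equiv> regularized_value U f \<delta> Pr X lam"

lemma f_continuous_on_U: "t \<ge> 0 \<Longrightarrow> continuous_on U (f t i)"
  by (rule lipschitz_on_continuous_on[of L])
    (use L f_lipschitz in \<open>auto intro!: lipschitz_onI simp: dist_norm\<close>)

lemma q_continuous: "continuous_on U (\<lambda>u. q u $ i)"
  by (rule lipschitz_on_continuous_on[of L])
    (use L q_lipschitz in \<open>auto intro!: lipschitz_onI simp: dist_norm\<close>)

text \<open>Continuity in time for each fixed action suffices, because the Lipschitz bound in the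
  action is uniform in time.\<close>

lemma f_jointly_continuous: "continuous_on ({0..} \<times> U) (\<lambda>(t, u). f t i u)"
  unfolding continuous_on_iff
proof (intro ballI allI impI)
  fix z :: "real \<times> (real ^ 'l)" and e :: real
  assume z: "z \<in> {0..} \<times> U" and e: "0 < e"
  obtain t u where tu: "z = (t, u)" "t \<ge> 0" "u \<in> U" using z by auto
  obtain d where d: "d > 0" "\<And>s. s \<ge> 0 \<Longrightarrow> dist s t < d \<Longrightarrow> dist (f s i u) (f t i u) < e / 2"
    using f_continuous[OF tu(3), of i, unfolded continuous_on_iff, rule_format, of t "e / 2"] tu e by auto
  define d' where "d' = min d (e / (2 * (L + 1)))"
  have "d' > 0" using d e L by (simp add: d'_def)
  show "\<exists>d>0. \<forall>z'\<in>{0..} \<times> U. dist z' z < d \<longrightarrow>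
      dist ((\<lambda>(t, u). f t i u) z') ((\<lambda>(t, u). f t i u) z) < e"
  proof (intro exI[of _ d'] conjI ballI impI \<open>d' > 0\<close>)
    fix z' assume z': "z' \<in> {0..} \<times> U" "dist z' z < d'"
    obtain s v where sv: "z' = (s, v)" "s \<ge> 0" "v \<in> U" using z' by auto
    have "dist s t < d'" "dist v u < d'"
      using z'(2) dist_fst_le[of z' z] dist_snd_le[of z' z] by (auto simp: sv tu)
    then have "dist s t < d" and v: "norm (v - u) \<le> e / (2 * (L + 1))" by (auto simp: d'_def dist_norm)
    have "\<bar>f s i v - f s i u\<bar> \<le> L * norm (v - u)" using f_lipschitz sv tu by blast
    also have "\<dots> \<le> L * (e / (2 * (L + 1)))" using v L by (intro mult_left_mono)
    also have "\<dots> \<le> e / 2" using L e by (simp add: field_simps)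
    finally have "\<bar>f s i v - f s i u\<bar> \<le> e / 2" .
    moreover have "\<bar>f s i u - f t i u\<bar> < e / 2"
      using d(2)[OF sv(2) \<open>dist s t < d\<close>] by (simp add: dist_real_def)
    ultimately have "\<bar>f s i v - f t i u\<bar> < e" by linarith
    then show "dist ((\<lambda>(t, u). f t i u) z') ((\<lambda>(t, u). f t i u) z) < e"
      by (simp add: sv tu dist_real_def)
  qed
qed

lemma averaged_reward_bound:
  assumes "\<mu> \<in> prob_measures_on U" "t \<ge> 0"
  shows "\<bar>averaged_reward f \<mu> t i\<bar> \<le> E t"
proof -
  interpret prob_space \<mu> using assms by (simp add: prob_measures_on_def)
  have sets: "sets \<mu> = sets (restrict_space borel U)" using assms by (simp add: prob_measures_on_def)
  have space: "space \<mu> = U" using sets_eq_imp_space_eq[OF sets] by (simp add: space_restrict_space)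
  have int: "integrable \<mu> (f t i)"
    by (rule integrable_continuous_on_compact[OF finite_measure_axioms sets compact_U f_continuous_on_U[OF assms(2)]])
  have "\<bar>averaged_reward f \<mu> t i\<bar> \<le> (\<integral>u. \<bar>f t i u\<bar> \<partial>\<mu>)"
    unfolding averaged_reward_def by (rule integral_abs_bound)
  also have "\<dots> \<le> (\<integral>u. E t \<partial>\<mu>)"
    using int f_le[OF assms(2)] by (intro integral_mono) (auto simp: space)
  finally show ?thesis by (simp add: prob_space)
qed

lemma averaged_reward_continuous:
  assumes "\<mu> \<in> prob_measures_on U"
  shows "continuous_on {0..} (\<lambda>t. averaged_reward f \<mu> t i)"
  unfolding continuous_on_eq_continuous_within
proof
  fix t :: real assume t: "t \<in> {0..}"
  \<comment> \<open>Continuity of parameter integrals needs a compact set of times; this one is a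
    neighbourhood of \<open>t\<close> relative to \<open>{0..}\<close>.\<close>
  have "continuous_on {0..t + 1} (\<lambda>t. \<integral>u. f t i u \<partial>\<mu>)"
  proof (rule continuous_on_integral_param[OF _ _ compact_U])
    show "finite_measure \<mu>" "sets \<mu> = sets (restrict_space borel U)"
      using assms by (auto simp: prob_measures_on_def prob_space.finite_measure)
    show "continuous_on ({0..t + 1} \<times> U) (\<lambda>(t, u). f t i u)"
      by (rule continuous_on_subset[OF f_jointly_continuous]) auto
  qed simp
  then have "continuous (at t within {0..t + 1}) (\<lambda>t. averaged_reward f \<mu> t i)"
    using t by (simp add: averaged_reward_def continuous_on_eq_continuous_within)
  moreover have "at t within {0..t + 1} = at t within {0..}"
    by (rule at_within_nhd[of _ "{..<t + 1}"]) auto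
  ultimately show "continuous (at t within {0..}) (\<lambda>t. averaged_reward f \<mu> t i)" by simp
qed

lemma reward_continuous: "\<pi> \<in> relaxed_controls U \<Longrightarrow> continuous_on {0..} (reward \<pi> j)"
  unfolding reward_def
  by (intro continuous_intros averaged_reward_continuous \<delta>_continuous) (simp add: relaxed_controls_def)

lemma reward_bound:
  assumes "\<pi> \<in> relaxed_controls U" "s \<ge> 0" "\<bar>entropy_of \<pi> j\<bar> \<le> h"
  shows "\<bar>reward \<pi> j s\<bar> \<le> E s + lam * h * \<delta> s"
proof -
  have "\<bar>lam * \<delta> s * entropy_of \<pi> j\<bar> \<le> lam * \<delta> s * h"
    using lam \<delta>_nonneg[OF assms(2)] assms(3) by (simp add: abs_mult mult_left_mono)
  moreover have "\<bar>averaged_reward f (\<pi> j) s j\<bar> \<le> E s"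
    using assms by (intro averaged_reward_bound) (auto simp: relaxed_controls_def)
  ultimately show ?thesis unfolding reward_def by (simp add: mult_ac)
qed

lemma envelope_integrable: "set_integrable lborel {0..} (\<lambda>s. E s + lam * h * \<delta> s)"
  by (intro set_integral_add set_integrable_mult_right E_integrable \<delta>_integrable)

lemma set_integrable_dominated:
  fixes g :: "real \<Rightarrow> real"
  assumes "set_borel_measurable lborel {0..} g" "\<And>s. s \<ge> 0 \<Longrightarrow> \<bar>g s\<bar> \<le> E s + lam * h * \<delta> s"
  shows "set_integrable lborel {0..} g"
  unfolding set_integrable_def
proof (rule Bochner_Integration.integrable_bound)
  show "integrable lborel (\<lambda>s. indicator {0..} s *\<^sub>R (E s + lam * h * \<delta> s))"
    using envelope_integrable unfolding set_integrable_def .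
  show "(\<lambda>s. indicator {0..} s *\<^sub>R g s) \<in> borel_measurable lborel"
    using assms(1) unfolding set_borel_measurable_def .
  show "AE s in lborel. norm (indicator {0..} s *\<^sub>R g s) \<le> norm (indicator {0..} s *\<^sub>R (E s + lam * h * \<delta> s))"
  proof (intro AE_I2)
    fix s :: real
    show "norm (indicator {0..} s *\<^sub>R g s) \<le> norm (indicator {0..} s *\<^sub>R (E s + lam * h * \<delta> s))"
      using assms(2)[of s] by (cases "s \<ge> 0") auto
  qed
qed

lemma set_borel_measurable_continuous:
  fixes g :: "real \<Rightarrow> real"
  shows "continuous_on {0..} g \<Longrightarrow> set_borel_measurable lborel {0..} g"
  unfolding set_borel_measurable_def
  using borel_measurable_continuous_on_indicator[of "{0..}" g] by simp

lemma reward_integrable: "\<pi> \<in> relaxed_controls U \<Longrightarrow> set_integrable lborel {0..} (reward \<pi> j)"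
  using reward_bound[OF _ _ order_refl]
  by (intro set_integrable_dominated set_borel_measurable_continuous reward_continuous)

lemma regular_imp_relaxed: "\<pi> \<in> regular_controls U \<Longrightarrow> \<pi> \<in> relaxed_controls U"
  by (simp add: regular_controls_def)

lemma value_eq:
  assumes mc: "markov_chain (Pr \<alpha> i) (X \<alpha>) A i"
    and int: "\<And>j. set_integrable lborel {0..} (\<lambda>s. reward (\<alpha> s) j s)"
  shows "V \<alpha> $ i = (\<Sum>j\<in>UNIV. LBINT s:{0..}. marginal_law (Pr \<alpha> i) (X \<alpha>) s $ j * reward (\<alpha> s) j s)"
  using markov_chain_expected_payoff(1)[OF mc int]
  by (simp add: regularized_value_def reward_def entropy_of_def)

lemma markov_chain_stationary:
  "\<pi> \<in> regular_controls U \<Longrightarrow>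
    markov_chain (Pr (\<lambda>_. \<pi>) i) (X (\<lambda>_. \<pi>)) (\<lambda>_. control_generator q \<pi>) i"
  using chains by (simp add: controlled_chains_def)

lemma prob_space_stationary: "\<pi> \<in> regular_controls U \<Longrightarrow> prob_space (Pr (\<lambda>_. \<pi>) i)"
  using markov_chain_stationary[of \<pi> i] by (simp add: markov_chain_def)

lemma law_forward:
  "\<pi> \<in> regular_controls U \<Longrightarrow> forward_solution (\<lambda>_. control_generator q \<pi>) (axis i 1) T (law \<pi> i)"
  unfolding law_def by (rule markov_chain_marginal_law[OF markov_chain_stationary])

lemma law_nonneg: "law \<pi> i t $ j \<ge> 0"
  unfolding law_def by (rule marginal_law_nonneg)

lemma law_le_1: "\<pi> \<in> regular_controls U \<Longrightarrow> law \<pi> i t $ j \<le> 1"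
  unfolding law_def by (rule marginal_law_le_1[OF prob_space_stationary])

lemma norm_law_le: "\<pi> \<in> regular_controls U \<Longrightarrow> norm (law \<pi> i t) \<le> real CARD('d)"
  unfolding law_def by (rule norm_marginal_law_le[OF prob_space_stationary])

lemma law_continuous:
  assumes "\<pi> \<in> regular_controls U"
  shows "continuous_on {0..T} (law \<pi> i)"
proof (cases "T \<ge> 0")
  case True
  then show ?thesis by (rule forward_solution_continuous[OF law_forward[OF assms]])
qed simp

lemma stationary_value_eq:
  assumes "\<pi> \<in> regular_controls U"
  shows "V (\<lambda>_. \<pi>) $ i = (\<Sum>j\<in>UNIV. LBINT s:{0..}. law \<pi> i s $ j * reward \<pi> j s)"
  unfolding law_def
  by (rule value_eq[OF markov_chain_stationary[OF assms] reward_integrable[OF regular_imp_relaxed[OF assms]]])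

lemma law_reward_integrable:
  assumes "\<pi> \<in> regular_controls U"
  shows "set_integrable lborel {0..} (\<lambda>s. law \<pi> i s $ j * reward \<pi> j s)"
  unfolding law_def
  by (rule markov_chain_expected_payoff(2)[OF markov_chain_stationary[OF assms]
      reward_integrable[OF regular_imp_relaxed[OF assms]]])

lemma law_mult_bound: "\<pi> \<in> regular_controls U \<Longrightarrow> \<bar>law \<pi> i s $ j * x\<bar> \<le> \<bar>x\<bar>"
  using law_nonneg[of \<pi> i s j] law_le_1[of \<pi> i s j] mult_right_mono[of "law \<pi> i s $ j" 1 "\<bar>x\<bar>"]
  by (simp add: abs_mult)

text \<open>Bounding each coordinate of the law by 1 costs the factor \<open>CARD('d)\<close>. What
  matters is that the bound is affine in \<open>h\<close>, so that logarithmic growth of the entropy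
  passes on to the value.\<close>

lemma value_bound:
  assumes \<pi>: "\<pi> \<in> regular_controls U" and h: "\<And>j. \<bar>entropy_of \<pi> j\<bar> \<le> h"
  shows "\<bar>V (\<lambda>_. \<pi>) $ i\<bar> \<le> real CARD('d) * ((LBINT s:{0..}. E s) + lam * h * (LBINT s:{0..}. \<delta> s))"
proof -
  have "\<bar>LBINT s:{0..}. law \<pi> i s $ j * reward \<pi> j s\<bar> \<le> (LBINT s:{0..}. E s + lam * h * \<delta> s)" for j
  proof -
    have le: "\<bar>law \<pi> i s $ j * reward \<pi> j s\<bar> \<le> E s + lam * h * \<delta> s" if "s \<in> {0..}" for s
      using law_mult_bound[OF \<pi>, of i s j "reward \<pi> j s"]
        reward_bound[OF regular_imp_relaxed[OF \<pi>] _ h[of j], of s] that by simp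
    have "\<bar>LBINT s:{0..}. law \<pi> i s $ j * reward \<pi> j s\<bar> \<le> (LBINT s:{0..}. \<bar>law \<pi> i s $ j * reward \<pi> j s\<bar>)"
      using set_integral_norm_bound[OF law_reward_integrable[OF \<pi>, of i j]] by simp
    also have "\<dots> \<le> (LBINT s:{0..}. E s + lam * h * \<delta> s)"
      by (intro set_integral_mono set_integrable_abs law_reward_integrable[OF \<pi>] envelope_integrable le)
    finally show ?thesis .
  qed
  then have "\<bar>V (\<lambda>_. \<pi>) $ i\<bar> \<le> (\<Sum>j\<in>(UNIV :: 'd set). LBINT s:{0..}. E s + lam * h * \<delta> s)"
    unfolding stationary_value_eq[OF \<pi>] by (intro order_trans[OF sum_abs] sum_mono)
  also have "\<dots> = real CARD('d) * ((LBINT s:{0..}. E s) + lam * h * (LBINT s:{0..}. \<delta> s))"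
    using E_integrable \<delta>_integrable by (subst set_integral_add) auto
  finally show ?thesis .
qed

end

section \<open>The fixed point\<close>

context control_problem
begin

text \<open>Up to an additive constant this is the logarithm of the Gibbs density; dividing by
  \<open>lam\<close> here keeps \<open>gibbs\<close> and the variational principle free of
  \<open>lam\<close>.\<close>

definition potential :: "real ^ 'd \<Rightarrow> 'd \<Rightarrow> real ^ 'l \<Rightarrow> real" where
  "potential y i u = 1 / lam * (f 0 i u + (q u $ i) \<bullet> y)"

abbreviation \<Gamma> :: "real ^ 'd \<Rightarrow> ('d, 'l) control" where
  "\<Gamma> \<equiv> gibbs_control U q f lam"

lemma gibbs_control_eq: "\<Gamma> y i = measure_of_density U (gibbs (potential y i))"
  by (simp add: gibbs_control_def gibbs_density_def[abs_def] gibbs_def[abs_def] potential_def[abs_def]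
      partition_function_def)

lemma potential_jointly_continuous: "continuous_on (K \<times> U) (\<lambda>(y, u). potential y i u)"
proof -
  have "continuous_on (K \<times> U) (\<lambda>z. 1 / lam * (f 0 i (snd z) + (q (snd z) $ i) \<bullet> fst z))"
    by (intro continuous_intros continuous_on_compose2[OF f_continuous_on_U[of 0 i]]
        continuous_on_compose2[OF q_continuous[of i]]) auto
  then show ?thesis by (simp add: potential_def case_prod_beta')
qed

lemma potential_continuous: "continuous_on U (potential y i)"
  unfolding potential_def[abs_def] by (intro continuous_intros f_continuous_on_U q_continuous) simp

lemma potential_lipschitz:
  assumes "u \<in> U" "v \<in> U"
  shows "\<bar>potential y i u - potential y i v\<bar> \<le> (L / lam * (1 + norm y)) * norm (u - v)"
proof -
  have "\<bar>(q u $ i - q v $ i) \<bullet> y\<bar> \<le> norm (q u $ i - q v $ i) * norm y"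
    by (rule Cauchy_Schwarz_ineq2)
  also have "\<dots> \<le> L * norm (u - v) * norm y"
    by (intro mult_right_mono q_lipschitz assms) simp
  finally have "\<bar>(f 0 i u - f 0 i v) + (q u $ i - q v $ i) \<bullet> y\<bar> \<le> L * norm (u - v) + L * norm (u - v) * norm y"
    using f_lipschitz[of 0 u v i] assms by linarith
  then have "1 / lam * \<bar>(f 0 i u - f 0 i v) + (q u $ i - q v $ i) \<bullet> y\<bar>
      \<le> 1 / lam * (L * norm (u - v) + L * norm (u - v) * norm y)"
    using lam by (intro mult_left_mono) auto
  moreover have "potential y i u - potential y i v = 1 / lam * ((f 0 i u - f 0 i v) + (q u $ i - q v $ i) \<bullet> y)"
    by (simp add: potential_def inner_diff_left diff_divide_distrib add_divide_distrib)
  moreover have "(L / lam * (1 + norm y)) * norm (u - v) = 1 / lam * (L * norm (u - v) + L * norm (u - v) * norm y)"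
    by (simp add: algebra_simps)
  ultimately show ?thesis using lam by (simp add: abs_mult)
qed

lemma gibbs_control_regular: "\<Gamma> y \<in> regular_controls U"
proof -
  have "gibbs (potential y i) \<in> prob_densities_on U" for i
    by (rule gibbs_in_prob_densities[OF potential_continuous])
  moreover from this have "measure_of_density U (gibbs (potential y i)) \<in> prob_measures_on U" for i
    by (rule measure_of_density_in_prob_measures)
  moreover have "diff_entropy U (gibbs (potential y i)) > - \<infinity>" for i
    by (simp add: diff_entropy_gibbs[OF potential_continuous])
  ultimately show ?thesis
    unfolding regular_controls_def relaxed_controls_def gibbs_control_eq by blast
qed

lemma integral_gibbs_control:
  "continuous_on U h \<Longrightarrow> (\<integral>u. h u \<partial>\<Gamma> y i) = (\<integral>u. gibbs (potential y i) u * h u \<partial>leb_on U)"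
  unfolding gibbs_control_eq
  by (rule integral_measure_of_density[OF gibbs_in_prob_densities[OF potential_continuous]])

lemma entropy_of_gibbs_control_eq: "entropy_of (\<Gamma> y) i = real_of_ereal (diff_entropy U (gibbs (potential y i)))"
  unfolding entropy_of_def gibbs_control_eq
  by (simp add: diff_entropy_density_of_measure[OF gibbs_in_prob_densities[OF potential_continuous]])

lemma entropy_of_gibbs_control:
  "entropy_of (\<Gamma> y) i = ln (partition_function (potential y i))
    - (\<integral>u. gibbs (potential y i) u * potential y i u \<partial>leb_on U)"
  by (simp add: entropy_of_gibbs_control_eq diff_entropy_gibbs[OF potential_continuous])

section \<open>Continuity of the fixed-point map on compact sets\<close>

context
  fixes K :: "(real ^ 'd) set"
  assumes K: "compact K"
begin

lemma continuous_on_integral_leb: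
  fixes \<phi> :: "real ^ 'd \<Rightarrow> real ^ 'l \<Rightarrow> real"
  shows "continuous_on (K \<times> U) (\<lambda>(y, u). \<phi> y u) \<Longrightarrow> continuous_on K (\<lambda>y. \<integral>u. \<phi> y u \<partial>leb_on U)"
  by (rule continuous_on_integral_param[OF leb.finite_measure_axioms sets_leb_on compact_U K])

lemma partition_function_continuous: "continuous_on K (\<lambda>y. partition_function (potential y i))"
  unfolding partition_function_def
  using continuous_on_exp[OF potential_jointly_continuous[of K i]]
  by (intro continuous_on_integral_leb) (simp add: case_prod_beta')

lemma gibbs_jointly_continuous: "continuous_on (K \<times> U) (\<lambda>(y, u). gibbs (potential y i) u)"
proof -
  have "continuous_on (K \<times> U) (\<lambda>z. exp (potential (fst z) i (snd z)) / partition_function (potential (fst z) i))"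
    using potential_jointly_continuous[of K i] partition_function_pos[OF potential_continuous]
    by (intro continuous_intros continuous_on_compose2[OF partition_function_continuous[of i]])
      (auto simp: case_prod_beta' less_imp_neq[symmetric])
  then show ?thesis by (simp add: gibbs_def case_prod_beta')
qed

lemma integral_gibbs_control_continuous:
  fixes h :: "real ^ 'l \<Rightarrow> real"
  assumes h: "continuous_on U h"
  shows "continuous_on K (\<lambda>y. \<integral>u. h u \<partial>\<Gamma> y i)"
  unfolding integral_gibbs_control[OF h]
proof (rule continuous_on_integral_leb)
  have "continuous_on (K \<times> U) (\<lambda>z. gibbs (potential (fst z) i) (snd z) * h (snd z))"
    using gibbs_jointly_continuous[of i]
    by (intro continuous_intros continuous_on_compose2[OF h]) (auto simp: case_prod_beta')
  then show "continuous_on (K \<times> U) (\<lambda>(y, u). gibbs (potential y i) u * h u)"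
    by (simp add: case_prod_beta')
qed

lemma entropy_of_gibbs_control_continuous: "continuous_on K (\<lambda>y. entropy_of (\<Gamma> y) i)"
proof -
  have "continuous_on (K \<times> U) (\<lambda>z. gibbs (potential (fst z) i) (snd z) * potential (fst z) i (snd z))"
    using gibbs_jointly_continuous[of i] potential_jointly_continuous[of K i]
    by (intro continuous_intros) (auto simp: case_prod_beta')
  then have "continuous_on (K \<times> U) (\<lambda>(y, u). gibbs (potential y i) u * potential y i u)"
    by (simp add: case_prod_beta')
  from continuous_on_integral_leb[OF this] show ?thesis
    unfolding entropy_of_gibbs_control
    using partition_function_pos[OF potential_continuous]
    by (intro continuous_intros partition_function_continuous) (auto simp: less_imp_neq[symmetric])
qed

lemma generator_gibbs_control_continuous: "continuous_on K (\<lambda>y. control_generator q (\<Gamma> y))"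
  unfolding control_generator_def
  by (intro continuous_on_vec_lambda integral_gibbs_control_continuous
      continuous_on_component q_continuous)

lemma reward_gibbs_control_continuous: "s \<ge> 0 \<Longrightarrow> continuous_on K (\<lambda>y. reward (\<Gamma> y) j s)"
  unfolding reward_def averaged_reward_def
  by (intro continuous_intros integral_gibbs_control_continuous f_continuous_on_U
      entropy_of_gibbs_control_continuous)

text \<open>The exponential in the stability estimate involves only the generator at the limit
  \<open>y\<close>, and all laws are bounded by \<open>CARD('d)\<close>. So only the difference of
  the generators varies along \<open>Y\<close>, and it tends to 0.\<close>

lemma law_gibbs_control_tendsto:
  assumes y: "y \<in> K" "\<And>n. Y n \<in> K" "Y \<longlonglongrightarrow> y" and t: "t \<ge> 0"
  shows "(\<lambda>n. law (\<Gamma> (Y n)) i t) \<longlonglongrightarrow> law (\<Gamma> y) i t"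
proof -
  obtain c :: real where c:
    "\<And>(A :: real ^ 'd ^ 'd) B x T p p' b.
      forward_solution (\<lambda>_. A) x T p \<Longrightarrow> forward_solution (\<lambda>_. B) x T p' \<Longrightarrow> 0 \<le> T \<Longrightarrow>
      (\<And>t. t \<in> {0..T} \<Longrightarrow> norm (p' t) \<le> b) \<Longrightarrow>
      (norm (p T - p' T))\<^sup>2 \<le> (c * b * norm (A - B))\<^sup>2 * T * exp ((2 * (c * norm A) + 1) * T)"
    using forward_solution_stability by metis
  define A where "A y = control_generator q (\<Gamma> y)" for y
  let ?b = "\<lambda>n. (c * real CARD('d) * norm (A y - A (Y n)))\<^sup>2 * t * exp ((2 * (c * norm (A y)) + 1) * t)"
  have "(\<lambda>n. A (Y n)) \<longlonglongrightarrow> A y"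
    using generator_gibbs_control_continuous y unfolding A_def
    by (auto simp: continuous_on_sequentially o_def)
  then have "?b \<longlonglongrightarrow> (c * real CARD('d) * norm (A y - A y))\<^sup>2 * t * exp ((2 * (c * norm (A y)) + 1) * t)"
    by (intro tendsto_intros)
  then have lim: "?b \<longlonglongrightarrow> 0" by simp
  have "(norm (law (\<Gamma> y) i t - law (\<Gamma> (Y n)) i t))\<^sup>2 \<le> ?b n" for n
    unfolding A_def
    by (rule c[OF law_forward law_forward t norm_law_le]) (rule gibbs_control_regular)+
  then have "(\<lambda>n. (norm (law (\<Gamma> y) i t - law (\<Gamma> (Y n)) i t))\<^sup>2) \<longlonglongrightarrow> 0"
    by (intro tendsto_sandwich[OF _ _ tendsto_const lim]) auto
  then have "(\<lambda>n. norm (law (\<Gamma> y) i t - law (\<Gamma> (Y n)) i t)) \<longlonglongrightarrow> 0"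
    by (simp add: power_tendsto_0_iff)
  then have "(\<lambda>n. norm (law (\<Gamma> (Y n)) i t - law (\<Gamma> y) i t)) \<longlonglongrightarrow> 0"
    by (simp add: norm_minus_commute)
  then show ?thesis
    by (simp add: tendsto_norm_zero_iff LIM_zero_iff)
qed

text \<open>Dominated convergence in time: laws and rewards converge at each time, and compactness
  of \<open>K\<close> bounds the entropies uniformly, which yields a common integrable
  bound.\<close>

lemma value_map_continuous: "continuous_on K (value_map U q f \<delta> Pr X lam)"
proof -
  have "continuous_on K (\<lambda>y. V (\<lambda>_. \<Gamma> y) $ i)" for i
    unfolding continuous_on_sequentially o_def
  proof (intro allI ballI impI)
    fix Y y assume y: "y \<in> K" and Y: "(\<forall>n. Y n \<in> K) \<and> Y \<longlonglongrightarrow> y"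
    have "compact ((\<lambda>y. entropy_of (\<Gamma> y) j) ` K)" for j
      by (rule compact_continuous_image[OF entropy_of_gibbs_control_continuous K])
    then have "bounded (\<Union>j. (\<lambda>y. entropy_of (\<Gamma> y) j) ` K)"
      by (intro bounded_Union) (auto intro: compact_imp_bounded)
    then obtain h where h: "\<forall>x\<in>\<Union>j. (\<lambda>y. entropy_of (\<Gamma> y) j) ` K. norm x \<le> h"
      unfolding bounded_iff by blast
    have h: "\<bar>entropy_of (\<Gamma> y) j\<bar> \<le> h" if "y \<in> K" for y j
      using h that by auto
    let ?g = "\<lambda>y j s. indicator {0..} s *\<^sub>R (law (\<Gamma> y) i s $ j * reward (\<Gamma> y) j s)"
    have "(\<lambda>n. \<Sum>j\<in>UNIV. \<integral>s. ?g (Y n) j s \<partial>lborel) \<longlonglongrightarrow> (\<Sum>j\<in>UNIV. \<integral>s. ?g y j s \<partial>lborel)"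
    proof (intro tendsto_sum integral_dominated_convergence[where w = "\<lambda>s. indicator {0..} s *\<^sub>R (E s + lam * h * \<delta> s)"])
      fix j
      show "?g y j \<in> borel_measurable lborel" "\<And>n. ?g (Y n) j \<in> borel_measurable lborel"
        using law_reward_integrable[OF gibbs_control_regular] unfolding set_integrable_def
        by (auto intro: borel_measurable_integrable)
      show "integrable lborel (\<lambda>s. indicator {0..} s *\<^sub>R (E s + lam * h * \<delta> s))"
        using envelope_integrable[of h] unfolding set_integrable_def .
      show "AE s in lborel. (\<lambda>n. ?g (Y n) j s) \<longlonglongrightarrow> ?g y j s"
      proof (rule AE_I2)
        fix s :: real
        show "(\<lambda>n. ?g (Y n) j s) \<longlonglongrightarrow> ?g y j s"
        proof (cases "s \<ge> 0")
          case True
          have "(\<lambda>n. reward (\<Gamma> (Y n)) j s) \<longlonglongrightarrow> reward (\<Gamma> y) j s"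
            using reward_gibbs_control_continuous[OF True, of j] y Y
            by (auto simp: continuous_on_sequentially o_def)
          then show ?thesis
            using law_gibbs_control_tendsto[OF y _ _ True, of Y i] Y
            by (intro tendsto_intros) auto
        qed simp
      qed
      fix n
      show "AE s in lborel. norm (?g (Y n) j s) \<le> indicator {0..} s *\<^sub>R (E s + lam * h * \<delta> s)"
      proof (rule AE_I2)
        fix s :: real
        show "norm (?g (Y n) j s) \<le> indicator {0..} s *\<^sub>R (E s + lam * h * \<delta> s)"
        proof (cases "s \<ge> 0")
          case True
          have "\<bar>law (\<Gamma> (Y n)) i s $ j * reward (\<Gamma> (Y n)) j s\<bar> \<le> E s + lam * h * \<delta> s"
            using law_mult_bound[OF gibbs_control_regular]
              reward_bound[OF regular_imp_relaxed[OF gibbs_control_regular] True h] Y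
            by (meson order_trans)
          with True show ?thesis by simp
        qed simp
      qed
    qed
    then show "(\<lambda>n. V (\<lambda>_. \<Gamma> (Y n)) $ i) \<longlonglongrightarrow> V (\<lambda>_. \<Gamma> y) $ i"
      by (simp add: stationary_value_eq[OF gibbs_control_regular] set_lebesgue_integral_def)
  qed
  then have "continuous_on K (\<lambda>y. \<chi> i. V (\<lambda>_. \<Gamma> y) $ i)"
    by (rule continuous_on_vec_lambda)
  then show ?thesis by (simp add: value_map_def[abs_def])
qed

end

lemma value_map_fixed_point:
  assumes "uniform_cone_condition k U"
  shows "\<exists>y. value_map U q f \<delta> Pr X lam y = y"
proof -
  obtain b where b: "b \<ge> 0"
    "\<And>g K. K \<ge> 0 \<Longrightarrow> (\<And>u v. u \<in> U \<Longrightarrow> v \<in> U \<Longrightarrow> \<bar>g u - g v\<bar> \<le> K * norm (u - v)) \<Longrightarrow>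
      \<bar>real_of_ereal (diff_entropy U (gibbs g))\<bar> \<le> b + real CARD('l) * ln (1 + K)"
    using gibbs_entropy_log_bound[OF assms] by metis
  define d where "d = real CARD('d)"
  define n where "n = real CARD('l)"
  define e0 where "e0 = (LBINT s:{0..}. E s)"
  define e1 where "e1 = (LBINT s:{0..}. \<delta> s)"
  have e1: "e1 \<ge> 0"
    unfolding e1_def set_lebesgue_integral_def by (intro Bochner_Integration.integral_nonneg) (auto simp: indicator_def \<delta>_nonneg)
  \<comment> \<open>One factor \<open>d\<close> stems from \<open>value_bound\<close>, the other
    from estimating the norm by the sum of the coordinates. The \<open>+ 1\<close> in
    \<open>L / lam + 1\<close> keeps this constant positive when \<open>L = 0\<close>.\<close>
  obtain R where R: "R > 0"
    "(d * d * (e0 + lam * b * e1)) + (d * d * lam * n * e1) * ln (1 + (L / lam + 1) * (1 + R)) \<le> R"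
    using sublinear_log_growth[of "L / lam + 1"] L lam by (metis add_nonneg_pos divide_nonneg_pos zero_less_one)
  \<comment> \<open>A common entropy bound for all Gibbs controls with
    \<open>norm y \<le> R\<close>.\<close>
  define h where "h = b + n * ln (1 + (L / lam + 1) * (1 + R))"
  have h: "\<bar>entropy_of (\<Gamma> y) j\<bar> \<le> h" if "norm y \<le> R" for y j
  proof -
    have K: "0 \<le> L / lam * (1 + norm y)" using L lam by simp
    have "\<bar>entropy_of (\<Gamma> y) j\<bar> \<le> b + n * ln (1 + L / lam * (1 + norm y))"
      unfolding entropy_of_gibbs_control_eq n_def by (rule b(2)[OF K potential_lipschitz])
    also have "L / lam * (1 + norm y) \<le> (L / lam + 1) * (1 + R)"
      using that L lam by (intro mult_mono) auto
    then have "b + n * ln (1 + L / lam * (1 + norm y)) \<le> h"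
      using K unfolding h_def n_def by (intro add_left_mono mult_left_mono) auto
    finally show ?thesis .
  qed
  have "value_map U q f \<delta> Pr X lam y \<in> cball 0 R" if "y \<in> cball 0 R" for y
  proof -
    have "\<bar>V (\<lambda>_. \<Gamma> y) $ i\<bar> \<le> d * (e0 + lam * h * e1)" for i
      unfolding d_def e0_def e1_def using that by (intro value_bound gibbs_control_regular h) simp
    then have "(\<Sum>i\<in>UNIV. \<bar>V (\<lambda>_. \<Gamma> y) $ i\<bar>) \<le> (\<Sum>i\<in>(UNIV :: 'd set). d * (e0 + lam * h * e1))"
      by (intro sum_mono)
    then have "norm (V (\<lambda>_. \<Gamma> y)) \<le> d * (d * (e0 + lam * h * e1))"
      using norm_le_l1_cart[of "V (\<lambda>_. \<Gamma> y)"] by (simp add: d_def)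
    also have "\<dots> = (d * d * (e0 + lam * b * e1)) + (d * d * lam * n * e1) * ln (1 + (L / lam + 1) * (1 + R))"
      by (simp add: h_def algebra_simps)
    also have "\<dots> \<le> R" by (rule R)
    finally show ?thesis by (simp add: value_map_def)
  qed
  then have "value_map U q f \<delta> Pr X lam \<in> cball 0 R \<rightarrow> cball 0 R" by (rule Pi_I)
  moreover have "cball (0 :: real ^ 'd) R \<noteq> {}" using R(1) by simp
  ultimately obtain y where "value_map U q f \<delta> Pr X lam y = y"
    using brouwer[OF compact_cball convex_cball _ value_map_continuous[OF compact_cball], of 0 R] by blast
  then show ?thesis by blast
qed

end

section \<open>Equilibrium\<close>

context control_problem
begin

lemma law_0: "\<pi> \<in> regular_controls U \<Longrightarrow> law \<pi> i 0 = axis i 1"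
  using forward_solution_initial[OF law_forward[of \<pi> i 0]] by simp

text \<open>The law runs on the time \<open>s - \<epsilon>\<close> since the restart, while
  \<open>reward\<close> keeps the calendar time \<open>s\<close>; for \<epsilon> = 0 this is the
  value of \<open>\<pi>\<close> with start in \<open>k\<close>.\<close>

definition continuation :: "('d, 'l) control \<Rightarrow> 'd \<Rightarrow> real \<Rightarrow> real" where
  "continuation \<pi> k \<epsilon> = (\<Sum>j\<in>UNIV. LBINT s:{\<epsilon>..}. law \<pi> k (s - \<epsilon>) $ j * reward \<pi> j s)"

definition initial_payoff :: "('d, 'l) control \<Rightarrow> 'd \<Rightarrow> real \<Rightarrow> real" where
  "initial_payoff \<pi> i \<epsilon> = (\<Sum>j\<in>UNIV. LBINT s:{0..<\<epsilon>}. law \<pi> i s $ j * reward \<pi> j s)"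

lemma shifted_law_measurable:
  assumes \<pi>: "\<pi> \<in> regular_controls U" and \<epsilon>: "\<epsilon> \<ge> 0"
  shows "(\<lambda>s. indicator {\<epsilon>..} s *\<^sub>R (law \<pi> k (s - \<epsilon>) $ j * reward \<pi> j s)) \<in> borel_measurable lborel"
proof -
  have "continuous_on {\<epsilon>..} (\<lambda>s. law \<pi> k (s - \<epsilon>) $ j * reward \<pi> j s)"
  proof (intro continuous_intros continuous_on_component)
    have "continuous_on {0..} (law \<pi> k)"
      unfolding continuous_on_eq_continuous_within
    proof
      fix t :: real assume t: "t \<in> {0..}"
      have "continuous (at t within {0..t + 1}) (law \<pi> k)"
        using law_continuous[OF \<pi>, of "t + 1" k] t by (simp add: continuous_on_eq_continuous_within)
      moreover have "at t within {0..t + 1} = at t within {0..}"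
        by (rule at_within_nhd[of _ "{..<t + 1}"]) auto
      ultimately show "continuous (at t within {0..}) (law \<pi> k)" by simp
    qed
    then show "continuous_on {\<epsilon>..} (\<lambda>s. law \<pi> k (s - \<epsilon>))"
      by (rule continuous_on_compose2) (auto intro!: continuous_intros)
    show "continuous_on {\<epsilon>..} (reward \<pi> j)"
      by (rule continuous_on_subset[OF reward_continuous[OF regular_imp_relaxed[OF \<pi>]]]) (use \<epsilon> in auto)
  qed
  from borel_measurable_continuous_on_indicator[OF _ this] show ?thesis by simp
qed

lemma shifted_law_bound:
  assumes "\<pi> \<in> regular_controls U" "\<epsilon> \<ge> 0"
  shows "norm (indicator {\<epsilon>..} s *\<^sub>R (law \<pi> k (s - \<epsilon>) $ j * reward \<pi> j s))
    \<le> norm (indicator {0..} s *\<^sub>R reward \<pi> j s)"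
  using law_mult_bound[OF assms(1), of k "s - \<epsilon>" j "reward \<pi> j s"] assms(2)
  by (auto simp: indicator_def)

lemma shifted_law_integrable:
  assumes "\<pi> \<in> regular_controls U" "\<epsilon> \<ge> 0"
  shows "set_integrable lborel {\<epsilon>..} (\<lambda>s. law \<pi> k (s - \<epsilon>) $ j * reward \<pi> j s)"
  unfolding set_integrable_def
  by (rule Bochner_Integration.integrable_bound
      [OF reward_integrable[OF regular_imp_relaxed[OF assms(1)], of j, unfolded set_integrable_def]
          shifted_law_measurable[OF assms]])
    (rule AE_I2, rule shifted_law_bound[OF assms])

text \<open>Coordinates of laws are at most 1, so the rewards dominate for all shifts, and
  continuity of the law gives the pointwise limit.\<close>

lemma continuation_tendsto:
  assumes \<pi>: "\<pi> \<in> regular_controls U"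
  shows "(continuation \<pi> k \<longlongrightarrow> V (\<lambda>_. \<pi>) $ k) (at_right 0)"
proof (rule tendsto_at_right_sequentially[of 0 1])
  fix S :: "nat \<Rightarrow> real"
  assume S: "\<And>n. 0 < S n" "S \<longlonglongrightarrow> 0"
  have "(\<lambda>n. continuation \<pi> k (S n)) \<longlonglongrightarrow> (\<Sum>j\<in>UNIV. LBINT s:{0..}. law \<pi> k s $ j * reward \<pi> j s)"
    unfolding continuation_def set_lebesgue_integral_def
  proof (intro tendsto_sum integral_dominated_convergence)
    fix j
    show "(\<lambda>s. indicator {0..} s *\<^sub>R (law \<pi> k s $ j * reward \<pi> j s)) \<in> borel_measurable lborel"
      using shifted_law_measurable[OF \<pi>, of 0] by simp
    show "(\<lambda>s. indicator {S n..} s *\<^sub>R (law \<pi> k (s - S n) $ j * reward \<pi> j s)) \<in> borel_measurable lborel" for n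
      using shifted_law_measurable[OF \<pi>, of "S n"] S(1)[of n] by simp
    show "integrable lborel (\<lambda>s. norm (indicator {0..} s *\<^sub>R reward \<pi> j s))"
      using reward_integrable[OF regular_imp_relaxed[OF \<pi>], of j] unfolding set_integrable_def
      by (rule integrable_norm)
    show "AE s in lborel. norm (indicator {S n..} s *\<^sub>R (law \<pi> k (s - S n) $ j * reward \<pi> j s))
        \<le> norm (indicator {0..} s *\<^sub>R reward \<pi> j s)" for n
      by (intro AE_I2 shifted_law_bound[OF \<pi>]) (simp add: S(1) less_imp_le)
    \<comment> \<open>At \<open>s = 0\<close> the integrand is 0 for every \<open>n\<close>, but the
      limit function need not be; one point is negligible.\<close>
    have "(\<lambda>n. indicator {S n..} s *\<^sub>R (law \<pi> k (s - S n) $ j * reward \<pi> j s))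
        \<longlonglongrightarrow> indicator {0..} s *\<^sub>R (law \<pi> k s $ j * reward \<pi> j s)" if "s \<noteq> 0" for s
    proof (cases "s > 0")
      case True
      have ev: "\<forall>\<^sub>F n in sequentially. S n < s"
        using order_tendstoD(2)[OF S(2) True] .
      have "(\<lambda>n. s - S n) \<longlonglongrightarrow> s - 0"
        by (intro tendsto_intros S)
      moreover have "continuous (at s within {0..s + 1}) (law \<pi> k)"
        using law_continuous[OF \<pi>, of "s + 1" k] True by (simp add: continuous_on_eq_continuous_within)
      then have "isCont (law \<pi> k) s"
        using True by (simp add: at_within_Icc_at)
      ultimately have "(\<lambda>n. law \<pi> k (s - S n)) \<longlonglongrightarrow> law \<pi> k s"
        by (intro isCont_tendsto_compose[where g = "law \<pi> k"]) auto
      then have "(\<lambda>n. law \<pi> k (s - S n) $ j * reward \<pi> j s) \<longlonglongrightarrow> law \<pi> k s $ j * reward \<pi> j s"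
        by (intro tendsto_intros)
      then have "(\<lambda>n. indicator {S n..} s *\<^sub>R (law \<pi> k (s - S n) $ j * reward \<pi> j s))
          \<longlonglongrightarrow> law \<pi> k s $ j * reward \<pi> j s"
        by (rule Lim_transform_eventually) (use ev in \<open>auto elim!: eventually_mono\<close>)
      with True show ?thesis by simp
    next
      case False
      with that have "s < 0" by simp
      moreover have "\<not> S n \<le> s" for n
        using S(1)[of n] \<open>s < 0\<close> by linarith
      ultimately show ?thesis by simp
    qed
    then show "AE s in lborel. (\<lambda>n. indicator {S n..} s *\<^sub>R (law \<pi> k (s - S n) $ j * reward \<pi> j s))
        \<longlonglongrightarrow> indicator {0..} s *\<^sub>R (law \<pi> k s $ j * reward \<pi> j s)"
      using AE_lborel_singleton[of 0] by (auto elim!: eventually_mono)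
  qed
  then show "(\<lambda>n. continuation \<pi> k (S n)) \<longlonglongrightarrow> V (\<lambda>_. \<pi>) $ k"
    by (simp add: stationary_value_eq[OF \<pi>])
qed simp

text \<open>The fundamental theorem of calculus at time 0, where the law is concentrated in
  \<open>i\<close>.\<close>

lemma initial_payoff_derivative:
  assumes \<pi>: "\<pi> \<in> regular_controls U"
  shows "((\<lambda>\<epsilon>. initial_payoff \<pi> i \<epsilon> / \<epsilon>) \<longlongrightarrow> reward \<pi> i 0) (at_right 0)"
proof -
  define \<phi> where "\<phi> s = (\<Sum>j\<in>UNIV. law \<pi> i s $ j * reward \<pi> j s)" for s
  have \<phi>_cont: "continuous_on {0..1} \<phi>"
    unfolding \<phi>_def
    by (intro continuous_intros continuous_on_component law_continuous[OF \<pi>]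
        continuous_on_subset[OF reward_continuous[OF regular_imp_relaxed[OF \<pi>]]]) auto
  have \<phi>_0: "\<phi> 0 = reward \<pi> i 0"
    unfolding \<phi>_def law_0[OF \<pi>] axis_def by (simp add: if_distrib[of "\<lambda>x. x * _"] cong: if_cong)
  have eq: "initial_payoff \<pi> i \<epsilon> = integral {0..\<epsilon>} \<phi>" if "\<epsilon> > 0" for \<epsilon>
  proof -
    have int: "set_integrable lborel {0..<\<epsilon>} (\<lambda>s. law \<pi> i s $ j * reward \<pi> j s)" for j
      by (rule set_integrable_subset[OF law_reward_integrable[OF \<pi>]]) auto
    have "initial_payoff \<pi> i \<epsilon> = (\<Sum>j\<in>UNIV. integral {0..<\<epsilon>} (\<lambda>s. law \<pi> i s $ j * reward \<pi> j s))"
      unfolding initial_payoff_def using set_borel_integral_eq_integral(2)[OF int] by simp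
    also have "\<dots> = integral {0..<\<epsilon>} \<phi>"
      unfolding \<phi>_def using set_borel_integral_eq_integral(1)[OF int] by (subst integral_sum) auto
    \<comment> \<open>The half-open interval comes from splitting at \<epsilon>; differentiation of
      the integral wants a closed one.\<close>
    also have "\<dots> = integral {0..\<epsilon>} \<phi>"
    proof (rule integral_subset_negligible)
      have "{0..\<epsilon>} - {0..<\<epsilon>} = {\<epsilon>}" using that by auto
      then show "negligible ({0..\<epsilon>} - {0..<\<epsilon>})" by simp
    qed auto
    finally show ?thesis .
  qed
  have "((\<lambda>t. integral {0..t} \<phi>) has_real_derivative \<phi> 0) (at 0 within {0..1})"
    using integral_has_vector_derivative[OF \<phi>_cont, of 0]
    by (simp add: has_real_derivative_iff_has_vector_derivative)
  then have "((\<lambda>t. integral {0..t} \<phi> / t) \<longlongrightarrow> reward \<pi> i 0) (at_right 0)"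
    by (simp add: has_field_derivative_iff at_within_Icc_at_right \<phi>_0)
  then show ?thesis
    by (rule Lim_transform_eventually) (auto simp: eventually_at_filter eq)
qed

text \<open>The forward equation at time 0, where the law is the unit vector that selects row
  \<open>i\<close> of the generator.\<close>

lemma law_derivative:
  assumes \<pi>: "\<pi> \<in> regular_controls U"
  shows "((\<lambda>\<epsilon>. (law \<pi> i \<epsilon> $ k - axis i 1 $ k) / \<epsilon>) \<longlongrightarrow> control_generator q \<pi> $ i $ k) (at_right 0)"
proof -
  have "(law \<pi> i has_vector_derivative axis i 1 v* control_generator q \<pi>) (at 0 within {0..1})"
    using forward_solution_has_vector_derivative[OF law_forward[OF \<pi>], of 0 1 i] by (simp add: law_0[OF \<pi>])
  from bounded_linear.has_vector_derivative[OF bounded_linear_vec_nth this, of k]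
  have "((\<lambda>t. law \<pi> i t $ k) has_real_derivative (axis i 1 v* control_generator q \<pi>) $ k) (at 0 within {0..1})"
    by (simp add: has_real_derivative_iff_has_vector_derivative)
  moreover have "(axis i 1 v* control_generator q \<pi>) $ k = control_generator q \<pi> $ i $ k"
    by (simp add: vector_matrix_mult_def axis_def if_distrib[of "\<lambda>x. x * _"] if_distrib[of "\<lambda>x. _ * x"] cong: if_cong)
  ultimately show ?thesis
    by (simp add: has_field_derivative_iff at_within_Icc_at_right law_0[OF \<pi>])
qed

text \<open>Up to \<epsilon> the law is that of \<open>\<pi>'\<close> by uniqueness; from \<epsilon>
  on it is the mixture, over the state \<open>k\<close> at time \<epsilon>, of the laws of
  \<open>\<pi>\<close> started in \<open>k\<close>. Splitting the time integral at \<epsilon> gives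
  the two terms.\<close>

lemma concat_value_eq:
  assumes \<pi>': "\<pi>' \<in> regular_controls U" and \<pi>: "\<pi> \<in> regular_controls U" and \<epsilon>: "\<epsilon> > 0"
  shows "V (concat_control \<pi>' \<epsilon> \<pi>) $ i
    = initial_payoff \<pi>' i \<epsilon> + (\<Sum>k\<in>UNIV. law \<pi>' i \<epsilon> $ k * continuation \<pi> k \<epsilon>)"
proof -
  define \<alpha> where "\<alpha> = concat_control \<pi>' \<epsilon> \<pi>"
  have \<alpha>: "\<alpha> s = (if s < \<epsilon> then \<pi>' else \<pi>)" for s by (simp add: \<alpha>_def concat_control_def)
  define p where "p = marginal_law (Pr \<alpha> i) (X \<alpha>)"
  have mc: "markov_chain (Pr \<alpha> i) (X \<alpha>) (\<lambda>t. control_generator q (\<alpha> t)) i"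
    using chains \<pi> \<pi>' \<epsilon> by (simp add: controlled_chains_def \<alpha>_def)
  have fwd: "forward_solution (\<lambda>t. control_generator q (\<alpha> t)) (axis i 1) T p" for T
    unfolding p_def by (rule markov_chain_marginal_law[OF mc])
  have "forward_solution (\<lambda>_. control_generator q \<pi>') (axis i 1) \<epsilon> p"
    by (rule forward_solution_cong[OF fwd]) (simp add: \<alpha>)
  then have p_before: "p s = law \<pi>' i s" if "s \<in> {0..\<epsilon>}" for s
    by (rule forward_solution_unique[OF _ law_forward[OF \<pi>'] that])
  have p_after: "p s = (\<Sum>k\<in>UNIV. law \<pi>' i \<epsilon> $ k *\<^sub>R law \<pi> k (s - \<epsilon>))" if "s \<ge> \<epsilon>" for s
    using forward_solution_restart[OF fwd _ law_forward[OF \<pi>], of \<epsilon> s] \<epsilon> that p_before[of \<epsilon>] by (simp add: \<alpha>)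
  have Un: "{0..} = {0..<\<epsilon>} \<union> {\<epsilon>..}" using \<epsilon> by auto
  have int: "set_integrable lborel {0..} (\<lambda>s. reward (\<alpha> s) j s)" for j
    unfolding Un
  proof (rule set_integrable_Un)
    have "set_integrable lborel {0..<\<epsilon>} (reward \<pi>' j)"
      by (rule set_integrable_subset[OF reward_integrable[OF regular_imp_relaxed[OF \<pi>']]]) auto
    then show "set_integrable lborel {0..<\<epsilon>} (\<lambda>s. reward (\<alpha> s) j s)"
      by (rule set_integrable_cong[THEN iffD1, rotated -1]) (auto simp: \<alpha>)
    have "set_integrable lborel {\<epsilon>..} (reward \<pi> j)"
      by (rule set_integrable_subset[OF reward_integrable[OF regular_imp_relaxed[OF \<pi>]]]) (use \<epsilon> in auto)
    then show "set_integrable lborel {\<epsilon>..} (\<lambda>s. reward (\<alpha> s) j s)"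
      by (rule set_integrable_cong[THEN iffD1, rotated -1]) (auto simp: \<alpha>)
  qed auto
  have int': "set_integrable lborel {0..} (\<lambda>s. p s $ j * reward (\<alpha> s) j s)" for j
    unfolding p_def by (rule markov_chain_expected_payoff(2)[OF mc int])
  have "V \<alpha> $ i = (\<Sum>j\<in>UNIV. LBINT s:{0..}. p s $ j * reward (\<alpha> s) j s)"
    unfolding p_def by (rule value_eq[OF mc int])
  also have "\<dots> = (\<Sum>j\<in>UNIV. (LBINT s:{0..<\<epsilon>}. p s $ j * reward (\<alpha> s) j s)
      + (LBINT s:{\<epsilon>..}. p s $ j * reward (\<alpha> s) j s))"
    unfolding Un
    by (intro sum.cong refl set_integral_Un set_integrable_subset[OF int']) (use \<epsilon> in auto)
  also have "\<dots> = initial_payoff \<pi>' i \<epsilon> + (\<Sum>j\<in>UNIV. LBINT s:{\<epsilon>..}. p s $ j * reward (\<alpha> s) j s)"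
  proof -
    have "(LBINT s:{0..<\<epsilon>}. p s $ j * reward (\<alpha> s) j s) = (LBINT s:{0..<\<epsilon>}. law \<pi>' i s $ j * reward \<pi>' j s)" for j
      by (rule set_lebesgue_integral_cong) (auto simp: p_before \<alpha>)
    then show ?thesis by (simp add: sum.distrib initial_payoff_def)
  qed
  also have "(\<Sum>j\<in>UNIV. LBINT s:{\<epsilon>..}. p s $ j * reward (\<alpha> s) j s)
      = (\<Sum>k\<in>UNIV. law \<pi>' i \<epsilon> $ k * continuation \<pi> k \<epsilon>)"
  proof -
    have "(LBINT s:{\<epsilon>..}. p s $ j * reward (\<alpha> s) j s)
        = (\<Sum>k\<in>UNIV. law \<pi>' i \<epsilon> $ k * (LBINT s:{\<epsilon>..}. law \<pi> k (s - \<epsilon>) $ j * reward \<pi> j s))" for j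
    proof -
      have "(LBINT s:{\<epsilon>..}. p s $ j * reward (\<alpha> s) j s)
          = (LBINT s:{\<epsilon>..}. \<Sum>k\<in>UNIV. law \<pi>' i \<epsilon> $ k * (law \<pi> k (s - \<epsilon>) $ j * reward \<pi> j s))"
        by (rule set_lebesgue_integral_cong) (auto simp: p_after \<alpha> sum_distrib_right mult.assoc)
      also have "\<dots> = (\<integral>s. (\<Sum>k\<in>UNIV. law \<pi>' i \<epsilon> $ k *
          (indicator {\<epsilon>..} s *\<^sub>R (law \<pi> k (s - \<epsilon>) $ j * reward \<pi> j s))) \<partial>lborel)"
        unfolding set_lebesgue_integral_def
        by (intro Bochner_Integration.integral_cong) (auto simp: sum_distrib_left mult_ac)
      also have "\<dots> = (\<Sum>k\<in>UNIV. law \<pi>' i \<epsilon> $ k * (LBINT s:{\<epsilon>..}. law \<pi> k (s - \<epsilon>) $ j * reward \<pi> j s))"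
        unfolding set_lebesgue_integral_def
        using shifted_law_integrable[OF \<pi>, of \<epsilon>] \<epsilon> unfolding set_integrable_def
        by (subst Bochner_Integration.integral_sum) auto
      finally show ?thesis .
    qed
    then show ?thesis
      unfolding continuation_def sum_distrib_left by (simp only:) (rule sum.swap)
  qed
  finally show ?thesis unfolding \<alpha>_def .
qed

text \<open>\<open>\<pi>\<close> is the concatenation of itself with itself, so both values
  decompose in the same way, and \<open>continuation\<close> is multiplied only by difference
  quotients of laws. Hence its convergence is enough, without any rate.\<close>

lemma concat_value_derivative:
  assumes \<pi>': "\<pi>' \<in> regular_controls U" and \<pi>: "\<pi> \<in> regular_controls U"
  shows "((\<lambda>\<epsilon>. (V (concat_control \<pi>' \<epsilon> \<pi>) $ i - V (\<lambda>_. \<pi>) $ i) / \<epsilon>) \<longlongrightarrow>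
    (reward \<pi>' i 0 + control_generator q \<pi>' $ i \<bullet> V (\<lambda>_. \<pi>))
    - (reward \<pi> i 0 + control_generator q \<pi> $ i \<bullet> V (\<lambda>_. \<pi>))) (at_right 0)"
proof -
  let ?A' = "control_generator q \<pi>'" and ?A = "control_generator q \<pi>"
  \<comment> \<open>The terms \<open>axis i 1 $ k\<close> cancel; they are inserted so that each
    quotient has a limit of its own.\<close>
  have "((\<lambda>\<epsilon>. initial_payoff \<pi>' i \<epsilon> / \<epsilon> - initial_payoff \<pi> i \<epsilon> / \<epsilon>
      + (\<Sum>k\<in>UNIV. ((law \<pi>' i \<epsilon> $ k - axis i 1 $ k) / \<epsilon> - (law \<pi> i \<epsilon> $ k - axis i 1 $ k) / \<epsilon>) * continuation \<pi> k \<epsilon>))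
    \<longlongrightarrow> reward \<pi>' i 0 - reward \<pi> i 0 + (\<Sum>k\<in>UNIV. (?A' $ i $ k - ?A $ i $ k) * V (\<lambda>_. \<pi>) $ k)) (at_right 0)"
    by (intro tendsto_intros initial_payoff_derivative law_derivative continuation_tendsto \<pi> \<pi>')
  also have "(\<Sum>k\<in>UNIV. (?A' $ i $ k - ?A $ i $ k) * V (\<lambda>_. \<pi>) $ k)
      = ?A' $ i \<bullet> V (\<lambda>_. \<pi>) - ?A $ i \<bullet> V (\<lambda>_. \<pi>)"
    unfolding inner_vec_def by (simp add: sum_subtractf left_diff_distrib)
  finally have lim: "((\<lambda>\<epsilon>. initial_payoff \<pi>' i \<epsilon> / \<epsilon> - initial_payoff \<pi> i \<epsilon> / \<epsilon>
      + (\<Sum>k\<in>UNIV. ((law \<pi>' i \<epsilon> $ k - axis i 1 $ k) / \<epsilon> - (law \<pi> i \<epsilon> $ k - axis i 1 $ k) / \<epsilon>) * continuation \<pi> k \<epsilon>))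
    \<longlongrightarrow> (reward \<pi>' i 0 + ?A' $ i \<bullet> V (\<lambda>_. \<pi>)) - (reward \<pi> i 0 + ?A $ i \<bullet> V (\<lambda>_. \<pi>))) (at_right 0)"
    by (simp add: algebra_simps)
  have same: "concat_control \<pi> \<epsilon> \<pi> = (\<lambda>_. \<pi>)" for \<epsilon>
    by (simp add: concat_control_def)
  have "(V (concat_control \<pi>' \<epsilon> \<pi>) $ i - V (\<lambda>_. \<pi>) $ i) / \<epsilon>
      = initial_payoff \<pi>' i \<epsilon> / \<epsilon> - initial_payoff \<pi> i \<epsilon> / \<epsilon>
      + (\<Sum>k\<in>UNIV. ((law \<pi>' i \<epsilon> $ k - axis i 1 $ k) / \<epsilon> - (law \<pi> i \<epsilon> $ k - axis i 1 $ k) / \<epsilon>) * continuation \<pi> k \<epsilon>)"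
    if "\<epsilon> > 0" for \<epsilon>
  proof -
    have "(\<Sum>k\<in>UNIV. ((law \<pi>' i \<epsilon> $ k - axis i 1 $ k) / \<epsilon> - (law \<pi> i \<epsilon> $ k - axis i 1 $ k) / \<epsilon>) * continuation \<pi> k \<epsilon>)
        = (\<Sum>k\<in>UNIV. (law \<pi>' i \<epsilon> $ k * continuation \<pi> k \<epsilon> - law \<pi> i \<epsilon> $ k * continuation \<pi> k \<epsilon>) / \<epsilon>)"
      by (rule sum.cong[OF refl]) (simp add: diff_divide_distrib left_diff_distrib)
    also have "\<dots> = ((\<Sum>k\<in>UNIV. law \<pi>' i \<epsilon> $ k * continuation \<pi> k \<epsilon>)
        - (\<Sum>k\<in>UNIV. law \<pi> i \<epsilon> $ k * continuation \<pi> k \<epsilon>)) / \<epsilon>"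
      by (simp add: sum_subtractf flip: sum_divide_distrib)
    finally show ?thesis
      using concat_value_eq[OF \<pi>' \<pi> that, of i] concat_value_eq[OF \<pi> \<pi> that, of i]
      by (simp add: same diff_divide_distrib add_divide_distrib)
  qed
  then show ?thesis
    by (intro Lim_transform_eventually[OF lim]) (auto simp: eventually_at_filter)
qed

text \<open>The reward and the generator row are both integrals against \<open>\<pi> i\<close>, so
  together they are the integral of one function, the potential freed of its factor
  \<open>1 / lam\<close>.\<close>

lemma first_order_payoff_eq:
  assumes "\<pi> \<in> relaxed_controls U"
  shows "averaged_reward f (\<pi> i) 0 i + control_generator q \<pi> $ i \<bullet> y = lam * (\<integral>u. potential y i u \<partial>\<pi> i)"
proof -
  have \<pi>: "finite_measure (\<pi> i)" "sets (\<pi> i) = sets (restrict_space borel U)"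
    using assms by (auto simp: relaxed_controls_def prob_measures_on_def prob_space.finite_measure)
  note int = integrable_continuous_on_compact[OF \<pi> compact_U]
  have "lam * potential y i u = f 0 i u + (\<Sum>j\<in>UNIV. q u $ i $ j * y $ j)" for u
    using lam by (simp add: potential_def inner_vec_def)
  then have "lam * (\<integral>u. potential y i u \<partial>\<pi> i) = (\<integral>u. f 0 i u + (\<Sum>j\<in>UNIV. q u $ i $ j * y $ j) \<partial>\<pi> i)"
    by (metis (no_types, lifting) Bochner_Integration.integral_cong integral_mult_right_zero)
  also have "\<dots> = (\<integral>u. f 0 i u \<partial>\<pi> i) + (\<Sum>j\<in>UNIV. (\<integral>u. q u $ i $ j \<partial>\<pi> i) * y $ j)"
    using int[OF f_continuous_on_U[of 0 i]] int[OF continuous_on_component[OF q_continuous[of i]]]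
    by (subst Bochner_Integration.integral_add) (auto simp: Bochner_Integration.integral_sum)
  finally show ?thesis
    by (simp add: averaged_reward_def control_generator_def inner_vec_def)
qed

text \<open>As \<open>\<delta> 0 = 1\<close>, the entropy weight at time 0 is exactly
  \<open>lam\<close>; taking it out leaves mean potential plus entropy. The variational principle
  bounds this sum, and \<open>\<Gamma> y\<close> attains the bound.\<close>

lemma gibbs_control_optimal:
  assumes \<pi>: "\<pi> \<in> regular_controls U"
  shows "reward \<pi> i 0 + control_generator q \<pi> $ i \<bullet> y \<le> reward (\<Gamma> y) i 0 + control_generator q (\<Gamma> y) $ i \<bullet> y"
proof -
  have eq: "reward \<pi> i 0 + control_generator q \<pi> $ i \<bullet> y = lam * ((\<integral>u. potential y i u \<partial>\<pi> i) + entropy_of \<pi> i)"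
    if "\<pi> \<in> regular_controls U" for \<pi>
    using first_order_payoff_eq[OF regular_imp_relaxed[OF that], of i y]
    by (simp add: reward_def \<delta>_0 algebra_simps)
  obtain \<rho> where \<rho>: "\<rho> \<in> prob_densities_on U" "\<pi> i = measure_of_density U \<rho>" "diff_entropy U \<rho> > - \<infinity>"
    using \<pi> unfolding regular_controls_def by blast
  have "(\<integral>u. potential y i u \<partial>\<pi> i) + entropy_of \<pi> i \<le> ln (partition_function (potential y i))"
    using gibbs_variational_principle[OF potential_continuous \<rho>(1,3)]
    by (simp add: \<rho>(2) entropy_of_def integral_measure_of_density[OF \<rho>(1) potential_continuous]
        diff_entropy_density_of_measure[OF \<rho>(1)])
  also have "\<dots> = (\<integral>u. potential y i u \<partial>\<Gamma> y i) + entropy_of (\<Gamma> y) i"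
    by (simp add: entropy_of_gibbs_control integral_gibbs_control[OF potential_continuous])
  finally show ?thesis
    using lam by (simp add: eq[OF \<pi>] eq[OF gibbs_control_regular])
qed

text \<open>The derivative contains the value of \<open>\<Gamma> y\<close>, whereas
  \<open>\<Gamma> y\<close> is optimal for the functional built from \<open>y\<close>; the
  fixed-point equation identifies the two.\<close>

lemma gibbs_control_equilibrium:
  assumes fp: "value_map U q f \<delta> Pr X lam y = y"
  shows "regular_equilibrium U f \<delta> Pr X lam (\<Gamma> y)"
  unfolding regular_equilibrium_def
proof (intro conjI ballI allI gibbs_control_regular)
  fix \<pi>' :: "('d, 'l) control" and i
  assume \<pi>': "\<pi>' \<in> regular_controls U"
  let ?D = "(reward \<pi>' i 0 + control_generator q \<pi>' $ i \<bullet> y) - (reward (\<Gamma> y) i 0 + control_generator q (\<Gamma> y) $ i \<bullet> y)"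
  have "((\<lambda>\<epsilon>. ereal ((V (concat_control \<pi>' \<epsilon> (\<Gamma> y)) $ i - V (\<lambda>_. \<Gamma> y) $ i) / \<epsilon>)) \<longlongrightarrow> ereal ?D) (at_right 0)"
    using concat_value_derivative[OF \<pi>' gibbs_control_regular[of y], of i] fp by (simp add: value_map_def)
  then have "Limsup (at_right 0) (\<lambda>\<epsilon>. ereal ((V (concat_control \<pi>' \<epsilon> (\<Gamma> y)) $ i - V (\<lambda>_. \<Gamma> y) $ i) / \<epsilon>)) = ereal ?D"
    by (intro lim_imp_Limsup) auto
  also have "\<dots> \<le> 0"
    using gibbs_control_optimal[OF \<pi>', where i = i and y = y] by simp
  finally show "Limsup (at_right 0) (\<lambda>\<epsilon>. ereal ((V (concat_control \<pi>' \<epsilon> (\<Gamma> y)) $ i - V (\<lambda>_. \<Gamma> y) $ i) / \<epsilon>)) \<le> 0" .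
qed

end

theorem theorem3p1:
  fixes k :: "'l::finite"
    and U :: "(real ^ 'l) set"
    and q :: "real ^ 'l \<Rightarrow> real ^ 'd ^ 'd::finite"
    and f :: "real \<Rightarrow> 'd \<Rightarrow> real ^ 'l \<Rightarrow> real"
    and \<delta> :: "real \<Rightarrow> real"
    and Pr :: "('d, 'l) policy \<Rightarrow> 'd \<Rightarrow> 'w measure"
    and X :: "('d, 'l) policy \<Rightarrow> real \<Rightarrow> 'w \<Rightarrow> 'd"
    and lam :: real
  assumes U: "compact U" "measure lborel U > 0"
    and q: "\<And>u. u \<in> U \<Longrightarrow> rate_matrix (q u)"
    and \<delta>: "\<delta> 0 = 1" "\<And>t. t \<ge> 0 \<Longrightarrow> \<delta> t \<in> {0..1}" "antimono_on {0..} \<delta>"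
    and chains: "controlled_chains U q Pr X"
    and M: "(\<integral>\<^sup>+s\<in>{0..}. ((SUP i. SUP u\<in>U. ennreal \<bar>f s i u\<bar>) + ennreal (\<delta> s)) \<partial>lborel) < \<infinity>"
    and Theta: "(SUP t\<in>{0..}. SUP i. SUP u\<^sub>1\<in>U. SUP u\<^sub>2\<in>U - {u\<^sub>1}.
        ennreal (\<bar>f t i u\<^sub>1 - f t i u\<^sub>2\<bar> / norm (u\<^sub>1 - u\<^sub>2)
          + norm (q u\<^sub>1 $ i - q u\<^sub>2 $ i) / norm (u\<^sub>1 - u\<^sub>2))) < \<infinity>"
    and cone: "uniform_cone_condition k U"
    and cont: "\<And>i u. u \<in> U \<Longrightarrow> continuous_on {0..} (\<lambda>t. f t i u)" "continuous_on {0..} \<delta>"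
    and lam: "lam > 0"
  shows "(\<exists>y. value_map U q f \<delta> Pr X lam y = y) \<and>
    (\<forall>y. value_map U q f \<delta> Pr X lam y = y \<longrightarrow>
       gibbs_control U q f lam y \<in> regular_controls U \<and>
       regular_equilibrium U f \<delta> Pr X lam (gibbs_control U q f lam y))"
proof -
  obtain L where L: "L \<ge> 0"
    "\<And>t i u v. t \<ge> 0 \<Longrightarrow> u \<in> U \<Longrightarrow> v \<in> U \<Longrightarrow> \<bar>f t i u - f t i v\<bar> \<le> L * norm (u - v)"
    "\<And>i u v. u \<in> U \<Longrightarrow> v \<in> U \<Longrightarrow> norm (q u $ i - q v $ i) \<le> L * norm (u - v)"
    using ennreal_SUP_lipschitz_bound[OF Theta] by metis
  interpret action_space U
    using U by unfold_locales
  \<comment> \<open>\<open>L\<close> has to come first: finiteness of the envelope at every time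
    rests on the Lipschitz bound.\<close>
  obtain E where E: "set_integrable lborel {0..} E" "set_integrable lborel {0..} \<delta>"
    "\<And>t i u. t \<ge> 0 \<Longrightarrow> u \<in> U \<Longrightarrow> \<bar>f t i u\<bar> \<le> E t"
  proof (rule integrable_envelope[OF M cont])
    show "0 \<le> \<delta> t" if "t \<ge> 0" for t using \<delta>(2)[OF that] by simp
  qed (use L nonempty_U compact_imp_bounded[OF compact_U] in auto)
  interpret control_problem U q f \<delta> Pr X lam L E
    using chains L E cont \<delta> lam by unfold_locales auto
  show ?thesis
    using value_map_fixed_point[OF cone] gibbs_control_regular gibbs_control_equilibrium by blast
qed

end
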